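(* Let $P\subset\mathbb{R}^d$ be a convex polytope with $n$ vertices $p_1,\ldots,p_n$. Let $T$ be a triangulation of a compact oriented PL manifold $M$ of dimension $d$ with boundary $\partial M$, and let $L:V(T)\to\{1,2,\ldots,n\}$ be a labelling such that $f_{L,P}(\partial M)\subseteq\partial P$. Then for any $y\in P$ the triangulation $T$ contains at least $|\deg(L,\partial T)|$ $d$-simplices that are labelled as simplices in $\operatorname{cov}_P(y)$.
   Context: $V(T)$ is the set of vertices of $T$. $f_{L,P}:M\to\mathbb{R}^d$ is the simplicial (piecewise linear) map that sends each vertex $v\in V(T)$ to $p_{L(v)}$ and is affine on each simplex of $T$. The orientation of $M$ is given by compatible orientations of the $d$-simplices of $T$; $\partial M$ is a closed $(d-1)$-manifold with the induced orientation, and $\partial P$ (a $(d-1)$-sphere) carries the orientation induced as the boundary of $P$. When $f_{L,P}(\partial M)\subseteq\partial P$, $\deg(L,\partial T)$ denotes the (Brouwer) degree of the restriction $h=f_{L,P}|_{\partial M}:\partial M\to\partial P$. For $y\in\mathbb{R}^d$, $\operatorname{cov}_P(y)$ is the collection of all $d$-simplices $\operatorname{conv}(p_{i_0},\ldots,p_{i_d})$ with $1\le i_0<\cdots<i_d\le n$ (spanned by vertices of $P$) that contain $y$. A $d$-simplex of $T$ is "labelled as a simplex in $\operatorname{cov}_P(y)$" if the set of labels of its $d+1$ vertices is $\{i_0,\ldots,i_d\}$ for some simplex $\operatorname{conv}(p_{i_0},\ldots,p_{i_d})\in\operatorname{cov}_P(y)$. *)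

theory Defs
  imports "HOL-Analysis.Analysis" "HOL-Combinatorics.Combinatorics"
begin

section \<open>Piecewise linear manifolds\<close>

definition affine_map_on :: "'a::real_vector set \<Rightarrow> ('a \<Rightarrow> 'b::real_vector) \<Rightarrow> bool" where
  "affine_map_on S f \<longleftrightarrow>
     (\<forall>x\<in>S. \<forall>y\<in>S. \<forall>t\<in>{0..1}. f ((1 - t) *\<^sub>R x + t *\<^sub>R y) = (1 - t) *\<^sub>R f x + t *\<^sub>R f y)"

text \<open>Piecewise linear maps on compact polyhedra. In particular, \<open>X\<close> has to be the polyhedron of
  a finite simplicial complex.\<close>

definition pl_map_on :: "'a::euclidean_space set \<Rightarrow> ('a \<Rightarrow> 'b::real_vector) \<Rightarrow> bool" where
  "pl_map_on X f \<longleftrightarrow> (\<exists>K. simplicial_complex K \<and> \<Union>K = X \<and> (\<forall>S\<in>K. affine_map_on S f))"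

text \<open>A PL chart of dimension \<open>d\<close> at \<open>x\<close> is a (compact) neighbourhood \<open>U\<close> of \<open>x\<close> in \<open>M\<close> with a PL
  homeomorphism \<open>\<phi>\<close> onto a \<open>d\<close>-simplex \<open>D\<close>. A simplex being locally a half-space, this is the usual
  local model of a manifold with boundary.\<close>

definition pl_chart_at ::
  "nat \<Rightarrow> 'a::euclidean_space set \<Rightarrow> 'a \<Rightarrow> 'a set \<Rightarrow> 'a set \<Rightarrow> ('a \<Rightarrow> 'a) \<Rightarrow> bool" where
  "pl_chart_at d M x U D \<phi> \<longleftrightarrow>
     U \<subseteq> M \<and> x \<in> top_of_set M interior_of U \<and> int d simplex D \<and>
     (\<exists>\<psi>. homeomorphism U D \<phi> \<psi> \<and> pl_map_on U \<phi> \<and> pl_map_on D \<psi>)"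

definition compact_pl_manifold :: "nat \<Rightarrow> 'a::euclidean_space set \<Rightarrow> bool" where
  "compact_pl_manifold d M \<longleftrightarrow> compact M \<and> (\<forall>x\<in>M. \<exists>U D \<phi>. pl_chart_at d M x U D \<phi>)"

definition manifold_boundary :: "nat \<Rightarrow> 'a::euclidean_space set \<Rightarrow> 'a set" where
  "manifold_boundary d M = {x\<in>M. \<exists>U D \<phi>. pl_chart_at d M x U D \<phi> \<and> \<phi> x \<in> rel_frontier D}"


section \<open>Triangulations, labellings and orientations\<close>

definition simplex_vertices :: "'a::real_vector set \<Rightarrow> 'a set" where
  "simplex_vertices S = {v. v extreme_point_of S}"

definition complex_vertices :: "'a::real_vector set set \<Rightarrow> 'a set" where
  "complex_vertices T = {v. {v} \<in> T}"

text \<open>The map on the polyhedron of \<open>T\<close> that agrees with \<open>a\<close> on the vertices and is affine on each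
  simplex, in barycentric coordinates.\<close>

definition simplicial_map ::
  "'a::real_vector set set \<Rightarrow> ('a \<Rightarrow> 'b::real_vector) \<Rightarrow> 'a \<Rightarrow> 'b" where
  "simplicial_map T a x =
     (THE y. \<exists>S\<in>T. \<exists>u. (\<forall>v\<in>simplex_vertices S. 0 \<le> u v) \<and> sum u (simplex_vertices S) = 1 \<and>
        x = (\<Sum>v\<in>simplex_vertices S. u v *\<^sub>R v) \<and> y = (\<Sum>v\<in>simplex_vertices S. u v *\<^sub>R a v))"

definition orders_simplex :: "'a::real_vector list \<Rightarrow> 'a set \<Rightarrow> bool" where
  "orders_simplex vs S \<longleftrightarrow> distinct vs \<and> set vs = simplex_vertices S"

text \<open>An orientation assigns to each ordering of the vertices of a \<open>d\<close>-simplex of \<open>T\<close> a sign, with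
  even reorderings having the same sign. The orientations of two \<open>d\<close>-simplices with a common facet are
  compatible if they induce opposite orientations on it.\<close>

definition compatible_orientation ::
  "nat \<Rightarrow> 'a::euclidean_space set set \<Rightarrow> ('a list \<Rightarrow> int) \<Rightarrow> bool" where
  "compatible_orientation d T ori \<longleftrightarrow>
     (\<forall>S\<in>T. \<forall>vs. int d simplex S \<and> orders_simplex vs S \<longrightarrow>
        ori vs \<in> {1, -1} \<and>
        (\<forall>\<pi>. \<pi> permutes {..<length vs} \<longrightarrow> ori (permute_list \<pi> vs) = sign \<pi> * ori vs)) \<and>
     (\<forall>S\<in>T. \<forall>S'\<in>T. \<forall>v w vs. int d simplex S \<and> int d simplex S' \<and> v \<noteq> w \<and>
        orders_simplex (v # vs) S \<and> orders_simplex (w # vs) S' \<longrightarrow> ori (w # vs) = - ori (v # vs))"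

text \<open>The orientation of a \<open>(d-1)\<close>-simplex of the boundary, with vertices \<open>vs\<close>, that is induced from
  the (unique) \<open>d\<close>-simplex of which it is a facet; \<open>v\<close> is the opposite vertex. This is the convention
  of the simplicial boundary operator.\<close>

definition induced_orientation ::
  "nat \<Rightarrow> 'a::euclidean_space set set \<Rightarrow> ('a list \<Rightarrow> int) \<Rightarrow> 'a list \<Rightarrow> int" where
  "induced_orientation d T ori vs =
     ori ((THE v. \<exists>S\<in>T. int d simplex S \<and> orders_simplex (v # vs) S) # vs)"


section \<open>Orientation of Euclidean space and of the boundary of a convex body\<close>

text \<open>The coordinates of \<open>\<real>\<^sup>d\<close> are ordered by the linear order on the index type; \<open>card {..<i}\<close> is the
  position of \<open>i\<close>, counted from 0. The rows of the matrix are \<open>w\<^sub>k - w\<^sub>0\<close>.\<close>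

definition standard_orientation :: "(real^'d::{finite,linorder}) list \<Rightarrow> int" where
  "standard_orientation ws =
     (let D = det (\<chi> i. ws ! Suc (card {..<i}) - ws ! 0)
      in if D > 0 then 1 else if D < 0 then -1 else 0)"

text \<open>For points \<open>w\<^sub>1, \<dots>, w\<^sub>d\<close> in a supporting hyperplane of \<open>P\<close> and \<open>q\<close> in the interior of \<open>P\<close>, the
  vector \<open>w\<^sub>1 - q\<close> points outwards, and the orientation of \<open>q, w\<^sub>1, \<dots>, w\<^sub>d\<close> is that of the
  frame \<open>w\<^sub>1 - q, w\<^sub>2 - w\<^sub>1, \<dots>, w\<^sub>d - w\<^sub>1\<close>; it does not depend on \<open>q\<close>. So this is the
  orientation as the boundary of \<open>P\<close> (outward vector first).\<close>

definition frontier_orientation ::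
  "(real^'d::{finite,linorder}) set \<Rightarrow> (real^'d::{finite,linorder}) list \<Rightarrow> int" where
  "frontier_orientation P ws = (THE s. \<forall>q\<in>interior P. standard_orientation (q # ws) = s)"


section \<open>Brouwer degree of a simplexwise affine map from the boundary of \<open>M\<close> to that of \<open>P\<close>\<close>

text \<open>Below, \<open>h\<close> is affine on each simplex of the triangulation \<open>T\<close> of \<open>M\<close> and maps the boundary of
  \<open>M\<close> to the frontier of \<open>P\<close>. A point of the frontier is a regular value if it is not in the image of
  a simplex of the boundary of dimension less than \<open>d - 1\<close>. Then each of its preimages is in the
  relative interior of exactly one \<open>(d-1)\<close>-simplex of the boundary, and \<open>h\<close> is injective on that simplex.\<close>

definition boundary_complex :: "nat \<Rightarrow> 'a::euclidean_space set set \<Rightarrow> 'a set set" where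
  "boundary_complex d T = {F\<in>T. F \<subseteq> manifold_boundary d (\<Union>T)}"

definition regular_values ::
  "'b::euclidean_space set set \<Rightarrow> (real^'d::{finite,linorder}) set \<Rightarrow> ('b \<Rightarrow> real^'d::{finite,linorder}) \<Rightarrow>
     (real^'d::{finite,linorder}) set" where
  "regular_values T P h =
     {z \<in> frontier P. \<forall>F\<in>boundary_complex CARD('d) T. aff_dim F < int CARD('d) - 1 \<longrightarrow> z \<notin> h ` F}"

definition simplex_sign ::
  "'b::euclidean_space set set \<Rightarrow> ('b list \<Rightarrow> int) \<Rightarrow> (real^'d::{finite,linorder}) set \<Rightarrow>
     ('b \<Rightarrow> real^'d::{finite,linorder}) \<Rightarrow> 'b set \<Rightarrow> int" where
  "simplex_sign T ori P h F =
     (THE s. \<forall>vs. orders_simplex vs F \<longrightarrow>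
        induced_orientation CARD('d) T ori vs * frontier_orientation P (map h vs) = s)"

definition signed_preimage_count ::
  "'b::euclidean_space set set \<Rightarrow> ('b list \<Rightarrow> int) \<Rightarrow> (real^'d::{finite,linorder}) set \<Rightarrow>
     ('b \<Rightarrow> real^'d::{finite,linorder}) \<Rightarrow> real^'d::{finite,linorder} \<Rightarrow> int" where
  "signed_preimage_count T ori P h z =
     (\<Sum>F | F \<in> boundary_complex CARD('d) T \<and> (int CARD('d) - 1) simplex F \<and> z \<in> h ` F.
        simplex_sign T ori P h F)"

definition boundary_degree ::
  "'b::euclidean_space set set \<Rightarrow> ('b list \<Rightarrow> int) \<Rightarrow> (real^'d::{finite,linorder}) set \<Rightarrow>
     ('b \<Rightarrow> real^'d::{finite,linorder}) \<Rightarrow> int" where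
  "boundary_degree T ori P h =
     (THE k. \<forall>z\<in>regular_values T P h. signed_preimage_count T ori P h z = k)"


section \<open>Simplices spanned by vertices of \<open>P\<close>\<close>

definition cov ::
  "nat \<Rightarrow> (nat \<Rightarrow> real^'d::{finite,linorder}) \<Rightarrow> real^'d::{finite,linorder} \<Rightarrow>
     (real^'d::{finite,linorder}) set set" where
  "cov n p y =
     {C. \<exists>I. I \<subseteq> {1..n} \<and> card I = CARD('d) + 1 \<and> C = convex hull (p ` I) \<and>
         int CARD('d) simplex C \<and> y \<in> C}"

definition labelled_in_cov ::
  "nat \<Rightarrow> (nat \<Rightarrow> real^'d::{finite,linorder}) \<Rightarrow> real^'d::{finite,linorder} \<Rightarrow>
     ('b::real_vector \<Rightarrow> nat) \<Rightarrow> 'b set \<Rightarrow> bool" where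
  "labelled_in_cov n p y L S \<longleftrightarrow>
     (\<exists>I. I \<subseteq> {1..n} \<and> card I = CARD('d) + 1 \<and> convex hull (p ` I) \<in> cov n p y \<and>
          L ` simplex_vertices S = I)"

end

theory Submission
  imports Defs
begin

text \<open>Choose \<open>y'\<close> in the interior of \<open>P\<close>, close to \<open>y\<close> and off all degenerate simplices spanned by vertices
  of \<open>P\<close>; each nondegenerate one that contains \<open>y'\<close> then contains \<open>y\<close>. For a generic ray from \<open>y'\<close>, the
  signed number of facets of the image of an oriented \<open>d\<close>-simplex that the ray crosses does not depend on
  the ray, is at most 1 in absolute value, and vanishes if the image does not contain \<open>y'\<close>. Sum this over
  all \<open>d\<close>-simplices of \<open>T\<close>. The two cofacets of an inner \<open>(d-1)\<close>-simplex cancel, and what remains is the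
  signed number of crossings with the boundary of \<open>M\<close>, which for a ray close to the one through a
  regular value \<open>z\<close> is the signed number of preimages of \<open>z\<close>. So this number is the same for all
  \<open>z\<close>, hence it is the degree. That the \<open>(d-1)\<close>-simplices in the boundary are those with one cofacet
  follows from invariance of domain and of dimension.\<close>

text \<open>Three degeneracies occur at once: labels may repeat or span a flat simplex,
  \<open>z\<close> is regular only with respect to the boundary complex, and \<open>y\<close> is any
  point of \<open>P\<close>, possibly on the frontier. Hence two separate perturbations. Moving
  \<open>y\<close> to \<open>y'\<close> off the hulls of few labels makes each
  \<open>d\<close>-simplex of \<open>T\<close> contribute a constant. Moving the direction
  \<open>z - y'\<close> slightly makes the ray transversal to the images of all faces, inner ones
  included, while regularity of \<open>z\<close> keeps the crossings with boundary facets unchanged.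
  Flat facets have sign 0, whether or not the ray meets them. Independence of the regular value is a
  result, not an input: in the summation identity, one side does not mention \<open>z\<close>. As
  \<open>boundary_degree\<close> is a definite description over regular values, it has content only
  if one exists, which takes another genericity argument. That no facet has three cofacets comes
  from the orientation, not from the charts: three signs cannot be pairwise opposite.\<close>

section \<open>Crossings of a ray with the facets of a simplex\<close>

text \<open>If \<open>X\<^sub>i\<close> is a basis and \<open>x = \<Sum>c\<^sub>iX\<^sub>i\<close>, \<open>u = \<Sum>m\<^sub>iX\<^sub>i\<close>, then \<open>A\<close> is the segment of all \<open>s\<close> such that \<open>u\<close> is a
  nonnegative combination of \<open>x\<close> and the \<open>X\<^sub>i\<close> with coefficient \<open>s\<close> at \<open>x\<close>. Its lower end is \<open>0\<close> or
  some \<open>m\<^sub>i/c\<^sub>i\<close> with \<open>c\<^sub>i < 0\<close>, its upper end is some \<open>m\<^sub>i/c\<^sub>i\<close> with \<open>c\<^sub>i > 0\<close>. So the left side is the number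
  of lower minus the number of upper ends, which is nonzero only for a half-line.\<close>

lemma ray_endpoints:
  fixes m c :: "'i::finite \<Rightarrow> real"
  assumes G: "\<And>s i j. 0 \<le> s \<Longrightarrow> (\<And>k. s * c k \<le> m k) \<Longrightarrow> m i = s * c i \<Longrightarrow>
                0 < s \<and> (m j = s * c j \<longrightarrow> i = j)"
    and H: "(\<And>k. c k \<le> 0) \<Longrightarrow> (\<And>k. c k < 0)"
    and A_def: "A = {s. 0 \<le> s \<and> (\<forall>k. s * c k \<le> m k)}"
  shows "of_bool (0 \<in> A) - (\<Sum>i\<in>UNIV. sgn (c i) * of_bool (c i \<noteq> 0 \<and> m i / c i \<in> A))
           = (of_bool (\<forall>k. c k < 0) :: real)"
proof -
  define Ep where "Ep = {i. 0 < c i \<and> m i / c i \<in> A}"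
  define En where "En = {i. c i < 0 \<and> m i / c i \<in> A}"
  have inA: "s \<in> A \<longleftrightarrow> 0 \<le> s \<and> (\<forall>k. s * c k \<le> m k)" for s by (simp add: A_def)
  have convex: "t \<in> A" if "s \<in> A" "0 \<le> t" "\<And>k. t * c k \<le> m k \<or> t * c k \<le> s * c k" for s t
    using that unfolding inA by (meson order_trans)
  \<comment> \<open>Two upper ends both lie in \<open>A\<close>, so each bounds the other. Both
    constraints are then tight at the same point, and \<open>G\<close> allows only one tight
    constraint.\<close>
  have one_p: "i = j" if "i \<in> Ep" "j \<in> Ep" for i j
  proof -
    have c: "0 < c i" "0 < c j" and A: "m i / c i \<in> A" "m j / c j \<in> A"
      using that by (auto simp: Ep_def)
    have "m i / c i \<le> m j / c j" "m j / c j \<le> m i / c i"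
      using A c unfolding inA by (simp_all add: pos_le_divide_eq)
    then have "m i / c i = m j / c j" by (rule antisym)
    then have "m j = m i / c i * c j" "m i = m i / c i * c i"
      using c by (metis nonzero_eq_divide_eq less_irrefl)+
    then show ?thesis using G[of "m i / c i" i j] A(1) unfolding inA by metis
  qed
  have one_n: "i = j" if "i \<in> En" "j \<in> En" for i j
  proof -
    have c: "c i < 0" "c j < 0" and A: "m i / c i \<in> A" "m j / c j \<in> A"
      using that by (auto simp: En_def)
    have "m i / c i \<le> m j / c j" "m j / c j \<le> m i / c i"
      using A c unfolding inA by (simp_all add: neg_divide_le_eq)
    then have "m i / c i = m j / c j" by (rule antisym)
    then have "m j = m i / c i * c j" "m i = m i / c i * c i"
      using c by (metis nonzero_eq_divide_eq less_irrefl)+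
    then show ?thesis using G[of "m i / c i" i j] A(1) unfolding inA by metis
  qed
  have card1: "card E = of_bool (E \<noteq> {})" if one: "\<And>i j. i \<in> E \<Longrightarrow> j \<in> E \<Longrightarrow> i = j" for E :: "'i set"
  proof (cases "E = {}")
    case False
    then obtain i where "E = {i}" using one by blast
    then show ?thesis by simp
  qed simp
  have "(\<Sum>i\<in>UNIV. sgn (c i) * of_bool (c i \<noteq> 0 \<and> m i / c i \<in> A))
      = (\<Sum>i\<in>UNIV. of_bool (i \<in> Ep) - of_bool (i \<in> En))"
    by (rule sum.cong) (auto simp: Ep_def En_def sgn_if)
  also have "\<dots> = real (card Ep) - real (card En)"
    by (simp add: sum_subtractf of_bool_def sum.If_cases)
  also have "\<dots> = of_bool (Ep \<noteq> {}) - of_bool (En \<noteq> {})"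
    by (simp add: card1[of Ep, OF one_p] card1[of En, OF one_n])
  finally have S: "(\<Sum>i\<in>UNIV. sgn (c i) * of_bool (c i \<noteq> 0 \<and> m i / c i \<in> A))
     = (of_bool (Ep \<noteq> {}) - of_bool (En \<noteq> {}) :: real)" .
  \<comment> \<open>The smallest ratio \<open>m k / c k\<close> over positive \<open>c k\<close> is
    the upper end. It lies in \<open>A\<close> because it is above \<open>s\<close>, and constraints
    with \<open>c k \<le> 0\<close> only relax as \<open>s\<close> grows.\<close>
  have Ep: "Ep \<noteq> {} \<longleftrightarrow> A \<noteq> {} \<and> (\<exists>k. 0 < c k)"
  proof (intro iffI conjI)
    assume "A \<noteq> {} \<and> (\<exists>k. 0 < c k)"
    then obtain s where s: "s \<in> A" and ne: "{k. 0 < c k} \<noteq> {}" by auto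
    define i where "i = arg_min_on (\<lambda>k. m k / c k) {k. 0 < c k}"
    have i: "0 < c i" using arg_min_if_finite(1)[OF _ ne, of "\<lambda>k. m k / c k"] by (simp add: i_def)
    have mn: "m i / c i \<le> m k / c k" if "0 < c k" for k
      unfolding i_def by (rule arg_min_least) (use ne that in auto)
    have le: "s \<le> m i / c i" using s i unfolding inA by (simp add: pos_le_divide_eq)
    have "m i / c i \<in> A"
    proof (rule convex[OF s])
      show "0 \<le> m i / c i" using le s unfolding inA by linarith
      show "m i / c i * c k \<le> m k \<or> m i / c i * c k \<le> s * c k" for k
      proof (cases "0 < c k")
        case True then show ?thesis using mn[OF True] pos_le_divide_eq[OF True] by auto
      next
        case False then show ?thesis using le mult_right_mono_neg[of s "m i / c i" "c k"] by auto
      qed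
    qed
    then show "Ep \<noteq> {}" using i by (auto simp: Ep_def)
  qed (auto simp: Ep_def)
  have En: "En \<noteq> {} \<longleftrightarrow> A \<noteq> {} \<and> 0 \<notin> A"
  proof (intro iffI conjI)
    assume "En \<noteq> {}"
    then obtain i where i: "c i < 0" "m i / c i \<in> A" by (auto simp: En_def)
    have "0 < m i / c i" using G[of "m i / c i" i i] i unfolding inA by auto
    then have "m i < 0" using i by (simp add: zero_less_divide_iff)
    then show "0 \<notin> A" unfolding inA by (auto simp: not_le)
    show "A \<noteq> {}" using i by auto
  next
    assume "A \<noteq> {} \<and> 0 \<notin> A"
    then obtain s where s: "s \<in> A" and "0 \<notin> A" by auto
    then obtain j where j: "m j < 0" unfolding inA by (auto simp: not_le)
    have cj: "c j < 0"
    proof (rule ccontr)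
      assume "\<not> c j < 0"
      then have "0 \<le> s * c j" using s unfolding inA by simp
      then show False using s j unfolding inA by (meson not_le order_trans)
    qed
    then have ne: "{k. c k < 0} \<noteq> {}" by auto
    define i where "i = arg_min_on (\<lambda>k. - (m k / c k)) {k. c k < 0}"
    have i: "c i < 0" using arg_min_if_finite(1)[OF _ ne, of "\<lambda>k. - (m k / c k)"] by (simp add: i_def)
    have "- (m i / c i) \<le> - (m k / c k)" if "c k < 0" for k
      unfolding i_def by (rule arg_min_least) (use ne that in auto)
    then have mx: "m k / c k \<le> m i / c i" if "c k < 0" for k using that by simp
    have "0 < m j / c j" using j cj by (simp add: zero_less_divide_iff)
    then have pos: "0 < m i / c i" using mx[OF cj] by linarith
    have le: "m i / c i \<le> s" using s i unfolding inA by (simp add: neg_divide_le_eq)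
    have "m i / c i \<in> A"
    proof (rule convex[OF s])
      show "0 \<le> m i / c i" using pos by simp
      show "m i / c i * c k \<le> m k \<or> m i / c i * c k \<le> s * c k" for k
      proof (cases "c k < 0")
        case True then show ?thesis using mx[OF True] neg_divide_le_eq[OF True] by auto
      next
        case False then show ?thesis using le mult_right_mono[of "m i / c i" s "c k"] by auto
      qed
    qed
    then show "En \<noteq> {}" using i by (auto simp: En_def)
  qed
  have neg: "A \<noteq> {}" if "\<And>k. c k < 0"
  proof -
    define s where "s = Max (insert 0 (range (\<lambda>k. m k / c k)))"
    have "m k / c k \<le> s" for k unfolding s_def by (rule Max_ge) auto
    then have "s * c k \<le> m k" for k using that neg_divide_le_eq by blast
    moreover have "0 \<le> s" unfolding s_def by (rule Max_ge) auto
    ultimately show ?thesis using inA by blast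
  qed
  \<comment> \<open>\<open>H\<close> excludes the borderline case: without a positive
    \<open>c k\<close> all are nonpositive, hence all negative.\<close>
  have "(\<exists>k. 0 < c k) \<longleftrightarrow> \<not> (\<forall>k. c k < 0)" using H by (metis less_asym not_le)
  then show ?thesis unfolding S using Ep En neg by (auto simp: of_bool_def)
qed

section \<open>Determinants and coordinates for a family of rows\<close>

definition row_det :: "('d::finite \<Rightarrow> real^'d) \<Rightarrow> real" where
  "row_det X = det (\<chi> i. X i)"

text \<open>Cramer's rule for rows. It later turns a coordinate of the remaining vertex into the
  ratio of two facet determinants.\<close>

lemma row_det_upd:
  "row_det (X(i := \<Sum>j\<in>UNIV. c j *\<^sub>R X j)) = c i * row_det X"
proof -
  have "(X(i := \<Sum>j\<in>UNIV. c j *\<^sub>R X j)) =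
    (\<lambda>k. if k = i then \<Sum>j\<in>UNIV. (\<chi> j. c j) $ j *s row j (\<chi> k. X k) else row k (\<chi> k. X k))"
    by (auto simp: row_def scalar_mult_eq_scaleR)
  then have "(\<chi> k. (X(i := \<Sum>j\<in>UNIV. c j *\<^sub>R X j)) k) =
    (\<chi> k. if k = i then \<Sum>j\<in>UNIV. (\<chi> j. c j) $ j *s row j (\<chi> k. X k) else row k (\<chi> k. X k))"
    by (rule arg_cong)
  then show ?thesis unfolding row_det_def
    using cramer_lemma_transpose[of i "\<chi> j. c j" "\<chi> k. X k"] by (simp only: vec_lambda_beta)
qed

lemma row_det_swap:
  assumes "i \<noteq> j"
  shows "row_det (X \<circ> Transposition.transpose i j) = - row_det X"
  using det_permute_rows[of "Transposition.transpose i j" "\<chi> k. X k"] assms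
  by (simp add: row_det_def permutes_swap_id sign_swap_id comp_def)

lemma row_det_nonzero_iff:
  "row_det X \<noteq> 0 \<longleftrightarrow> (\<forall>c. (\<Sum>i\<in>UNIV. c i *\<^sub>R X i) = 0 \<longrightarrow> (\<forall>i. c i = 0))"
proof -
  have "row_det X \<noteq> 0 \<longleftrightarrow> (\<exists>B. (\<chi> k. X k) ** B = mat 1)"
    unfolding row_det_def using invertible_det_nz invertible_right_inverse by blast
  also have "\<dots> \<longleftrightarrow> (\<forall>c. (\<Sum>i\<in>UNIV. c i *s row i (\<chi> k. X k)) = 0 \<longrightarrow> (\<forall>i. c i = 0))"
    by (rule matrix_right_invertible_independent_rows)
  finally show ?thesis by (simp add: row_def scalar_mult_eq_scaleR)
qed

text \<open>Inverting the matrix gives coordinates linear in \<open>u\<close>. Their continuity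
  later makes strict cone membership an open condition.\<close>

lemma row_det_coordinates:
  assumes "row_det X \<noteq> 0"
  obtains f :: "real^'d \<Rightarrow> real^'d" where "continuous_on UNIV f" "\<And>u. u = (\<Sum>i\<in>UNIV. f u $ i *\<^sub>R X i)"
    "\<And>u c. u = (\<Sum>i\<in>UNIV. c i *\<^sub>R X i) \<Longrightarrow> c = ($) (f u)"
proof -
  define B where "B = transpose (\<chi> k. X k)"
  have "invertible B" using assms unfolding row_det_def B_def
    by (simp add: invertible_det_nz)
  then obtain C where C: "B ** C = mat 1" "C ** B = mat 1" by (auto simp: invertible_def)
  have Bv: "B *v c = (\<Sum>i\<in>UNIV. c $ i *\<^sub>R X i)" for c
    by (simp add: matrix_mult_sum B_def row_def scalar_mult_eq_scaleR)
  show ?thesis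
  proof (rule that[of "\<lambda>u. C *v u"])
    show "continuous_on UNIV ((*v) C)"
      by (rule matrix_vector_mult_linear_continuous_on)
    show e: "u = (\<Sum>i\<in>UNIV. (C *v u) $ i *\<^sub>R X i)" for u
      by (simp flip: Bv add: matrix_vector_mul_assoc C)
    show "c = ($) (C *v u)" if "u = (\<Sum>i\<in>UNIV. c i *\<^sub>R X i)" for u c
    proof -
      have "u = B *v (\<chi> i. c i)" using that by (simp add: Bv)
      then have "C *v u = (\<chi> i. c i)"
        by (simp add: matrix_vector_mul_assoc C)
      then show ?thesis by auto
    qed
  qed
qed

section \<open>Coordinate positions and reorderings of vertex lists\<close>

lemma bij_betw_card_lessThan:
  "bij_betw (\<lambda>i::'d::{finite,linorder}. card {..<i}) UNIV {..<CARD('d)}"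
proof -
  have mono: "card {..<i} < card {..<j}" if "i < j" for i j :: 'd
    using that by (intro psubset_card_mono) auto
  have "inj (\<lambda>i::'d. card {..<i})"
    by (rule injI) (metis mono less_irrefl linorder_less_linear)
  moreover have "card {..<i} < CARD('d)" for i :: 'd
    by (intro psubset_card_mono) auto
  ultimately show ?thesis
    by (intro bij_betw_imageI card_subset_eq) (auto simp: card_image)
qed

lemma card_lessThan_less: "card {..<i} < CARD('d)" for i :: "'d::{finite,linorder}"
  using bij_betw_card_lessThan[where ?'d='d] by (auto simp: bij_betw_def)

lemma card_lessThan_eq_iff: "card {..<i} = card {..<j} \<longleftrightarrow> i = j" for i :: "'d::{finite,linorder}"
  using bij_betw_card_lessThan[where ?'d='d] by (auto simp: bij_betw_def dest: injD)

lemma sgn_standard_orientation: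
  "of_int (standard_orientation (y # ws)) = sgn (row_det (\<lambda>i. ws ! card {..<i} - y))"
  by (simp add: standard_orientation_def row_det_def sgn_if Let_def)

lemma bij_betw_nth_card_lessThan:
  assumes "distinct ws" "length ws = CARD('d::{finite,linorder})"
  shows "bij_betw (\<lambda>i::'d. ws ! card {..<i}) UNIV (set ws)"
  using bij_betw_trans[OF bij_betw_card_lessThan[where ?'d='d] bij_betw_nth[OF assms(1) _ refl]] assms(2)
  by (simp add: comp_def)

text \<open>The part of \<open>compatible_orientation\<close> that concerns a single simplex, stated
  for a vertex set so that crossings can be counted without the geometry of
  \<open>T\<close>.\<close>

definition alternating_on :: "'b set \<Rightarrow> ('b list \<Rightarrow> int) \<Rightarrow> bool" where
  "alternating_on V ori \<longleftrightarrow> (\<forall>vs. distinct vs \<and> set vs = V \<longrightarrow> ori vs \<in> {1, -1} \<and>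
     (\<forall>\<pi>. \<pi> permutes {..<length vs} \<longrightarrow> ori (permute_list \<pi> vs) = sign \<pi> * ori vs))"

lemma alternating_on_swap:
  assumes "alternating_on V ori" "distinct vs" "set vs = V" "i < length vs" "j < length vs" "i \<noteq> j"
  shows "ori (permute_list (Transposition.transpose i j) vs) = - ori vs"
proof -
  have "Transposition.transpose i j permutes {..<length vs}"
    using assms by (simp add: permutes_swap_id)
  then show ?thesis using assms by (simp add: alternating_on_def sign_swap_id)
qed

lemma standard_orientation_swap:
  fixes y :: "real^'d::{finite,linorder}"
  assumes "length ws = CARD('d)" "i < length ws" "j < length ws" "i \<noteq> j"
  shows "standard_orientation (y # permute_list (Transposition.transpose i j) ws)
           = - standard_orientation (y # ws)"
proof -
  \<comment> \<open>List positions correspond to coordinates through \<open>card {..<i}\<close>, so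
    a swap in the list is a swap of matrix rows.\<close>
  obtain i' j' :: 'd where ij: "i = card {..<i'}" "j = card {..<j'}"
    using assms bij_betw_card_lessThan[where ?'d='d]
    by (metis bij_betw_imp_surj_on imageE lessThan_iff)
  have "i' \<noteq> j'" using assms(4) ij by auto
  have p: "Transposition.transpose i j permutes {..<length ws}"
    using assms by (simp add: permutes_swap_id)
  have "(\<lambda>k. permute_list (Transposition.transpose i j) ws ! card {..<k} - y)
      = (\<lambda>k. ws ! card {..<k} - y) \<circ> Transposition.transpose i' j'"
    using p assms card_lessThan_less[where ?'d='d]
    by (auto simp: permute_list_nth Transposition.transpose_def ij card_lessThan_eq_iff)
  then have "real_of_int (standard_orientation (y # permute_list (Transposition.transpose i j) ws))
       = - real_of_int (standard_orientation (y # ws))"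
    using row_det_swap[OF \<open>i' \<noteq> j'\<close>] by (simp add: sgn_standard_orientation sgn_minus)
  then show ?thesis by linarith
qed

lemma permute_list_Cons_transpose:
  assumes "i < length vs" "j < length vs"
  shows "permute_list (Transposition.transpose (Suc i) (Suc j)) (v # vs)
           = v # permute_list (Transposition.transpose i j) vs"
proof (rule nth_equalityI)
  fix k assume "k < length (permute_list (Transposition.transpose (Suc i) (Suc j)) (v # vs))"
  then show "permute_list (Transposition.transpose (Suc i) (Suc j)) (v # vs) ! k
           = (v # permute_list (Transposition.transpose i j) vs) ! k"
    using assms by (cases k) (auto simp: permute_list_def Transposition.transpose_def simp del: upt_Suc)
qed simp

text \<open>Transpositions generate all reorderings. It is applied to a product of two alternating
  signs, which every swap leaves unchanged.\<close>

lemma swap_invariant_imp_order_invariant: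
  assumes "distinct vs" "distinct ws" "set vs = set ws"
    and swap: "\<And>xs i j. distinct xs \<Longrightarrow> set xs = set ws \<Longrightarrow> i < length xs \<Longrightarrow> j < length xs \<Longrightarrow> i \<noteq> j \<Longrightarrow>
      f (permute_list (Transposition.transpose i j) xs) = f xs"
  shows "f vs = f ws"
proof -
  have "mset vs = mset ws" using assms by (simp add: set_eq_iff_mset_eq_distinct)
  then obtain p where p: "p permutes {..<length ws}" "permute_list p ws = vs"
    using mset_eq_permutation by blast
  have "\<forall>xs. distinct xs \<and> set xs = set ws \<and> length xs = length ws \<longrightarrow> f (permute_list p xs) = f xs"
    using p(1) finite_lessThan
  proof (induction rule: permutes_induct)
    case (swap a b q)
    show ?case
    proof (intro allI impI)
      fix xs assume xs: "distinct xs \<and> set xs = set ws \<and> length xs = length ws"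
      let ?t = "Transposition.transpose a b"
      have t: "?t permutes {..<length xs}" using swap xs by (simp add: permutes_swap_id)
      have "f (permute_list (?t \<circ> q) xs) = f (permute_list q (permute_list ?t xs))"
        using swap xs by (simp add: permute_list_compose)
      also have "\<dots> = f (permute_list ?t xs)"
        using swap xs t by simp
      also have "\<dots> = f xs"
        using assms(4)[of xs a b] swap xs by simp
      finally show "f (permute_list (?t \<circ> q) xs) = f xs" .
    qed
  qed simp
  then show ?thesis using p assms by blast
qed

section \<open>Facet signs and cones over facets\<close>

definition some_order :: "'b set \<Rightarrow> 'b list" where
  "some_order W = (SOME ws. distinct ws \<and> set ws = W)"

lemma some_order: "finite W \<Longrightarrow> distinct (some_order W) \<and> set (some_order W) = W"
  unfolding some_order_def using finite_distinct_list[of W] by (metis (mono_tags, lifting) someI_ex)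

text \<open>The sign with which a ray from \<open>y\<close> crosses the image of the facet
  \<open>W\<close> opposite \<open>v\<close>: the orientation that the simplex induces on
  \<open>W\<close>, times that of the frame \<open>a w - y\<close>. It is 0 if the frame is
  dependent. For alternating \<open>ori\<close> the two factors change sign together, so the choice
  in \<open>some_order\<close> is immaterial.\<close>

definition facet_sign ::
  "('b list \<Rightarrow> int) \<Rightarrow> ('b \<Rightarrow> real^'d::{finite,linorder}) \<Rightarrow> real^'d::{finite,linorder} \<Rightarrow> 'b \<Rightarrow> 'b set \<Rightarrow> int" where
  "facet_sign ori a y v W = ori (v # some_order W) * standard_orientation (y # map a (some_order W))"

lemma facet_sign_eq:
  fixes a :: "'b \<Rightarrow> real^'d::{finite,linorder}"
  assumes alt: "alternating_on (insert v W) ori" and "v \<notin> W" "distinct ws" "set ws = W" "card W = CARD('d)"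
  shows "facet_sign ori a y v W = ori (v # ws) * standard_orientation (y # map a ws)"
proof -
  have fin: "finite W" using assms(4) by auto
  show ?thesis unfolding facet_sign_def
  proof (rule swap_invariant_imp_order_invariant[where ws=ws])
    fix xs i j assume xs: "distinct xs" "set xs = set ws" "i < length xs" "j < length xs" "i \<noteq> j"
    let ?t = "Transposition.transpose i j"
    have len: "length xs = CARD('d)" using xs(1,2) assms by (metis distinct_card)
    have "ori (v # permute_list ?t xs) = - ori (v # xs)"
      using alternating_on_swap[OF alt, of "v # xs" "Suc i" "Suc j"] xs assms
      by (simp add: permute_list_Cons_transpose)
    moreover have "?t permutes {..<length xs}" using xs by (simp add: permutes_swap_id)
    then have "standard_orientation (y # map a (permute_list ?t xs)) = - standard_orientation (y # map a xs)"
      using standard_orientation_swap[of "map a xs" i j y] xs len by (simp add: permute_list_map)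
    ultimately show "ori (v # permute_list ?t xs) * standard_orientation (y # map a (permute_list ?t xs))
      = ori (v # xs) * standard_orientation (y # map a xs)" by simp
  qed (use assms some_order[OF fin] in auto)
qed

text \<open>For finite \<open>W\<close>, nonzero \<open>u\<close> and \<open>y\<close> outside the
  hull of the images of \<open>W\<close>, this says that the ray from \<open>y\<close> in direction
  \<open>u\<close> meets that hull.\<close>

definition in_cone :: "('b \<Rightarrow> 'v::real_vector) \<Rightarrow> 'v \<Rightarrow> 'v \<Rightarrow> 'b set \<Rightarrow> bool" where
  "in_cone a y u W \<longleftrightarrow> (\<exists>m. (\<forall>v\<in>W. 0 \<le> m v) \<and> u = (\<Sum>v\<in>W. m v *\<^sub>R (a v - y)))"

text \<open>Dividing the relation by its total weight exhibits \<open>y\<close> as a convex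
  combination.\<close>

lemma convex_hull_image_if_balanced:
  fixes a :: "'b \<Rightarrow> 'v::real_vector"
  assumes "finite W" "\<And>v. v \<in> W \<Longrightarrow> 0 \<le> m v" "0 < sum m W" "(\<Sum>v\<in>W. m v *\<^sub>R (a v - y)) = 0"
  shows "y \<in> convex hull (a ` W)"
proof -
  have "(\<Sum>v\<in>W. m v *\<^sub>R a v) = sum m W *\<^sub>R y"
    using assms(4) by (simp add: scaleR_diff_right sum_subtractf scaleR_left.sum)
  then have "y = (\<Sum>v\<in>W. (m v / sum m W) *\<^sub>R a v)"
    using assms(3) by (simp add: divide_inverse_commute flip: scaleR_scaleR scaleR_right.sum)
      (simp add: scaleR_scaleR)
  moreover have "(\<Sum>v\<in>W. (m v / sum m W) *\<^sub>R a v) \<in> convex hull (a ` W)"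
    using assms by (intro convex_sum convex_convex_hull)
      (auto simp: hull_inc simp flip: sum_divide_distrib)
  ultimately show ?thesis by simp
qed

lemma in_cone_iff_coordinates:
  fixes a :: "'b \<Rightarrow> real^'d" and f :: "real^'d \<Rightarrow> real^'d"
  assumes e: "bij_betw e UNIV W"
    and f: "\<And>u. u = (\<Sum>i\<in>UNIV. f u $ i *\<^sub>R (a (e i) - y))"
      "\<And>u c. u = (\<Sum>i\<in>UNIV. c i *\<^sub>R (a (e i) - y)) \<Longrightarrow> c = ($) (f u)"
  shows "in_cone a y u W \<longleftrightarrow> (\<forall>k. 0 \<le> f u $ k)"
proof
  assume "in_cone a y u W"
  then obtain m where m: "\<And>v. v \<in> W \<Longrightarrow> 0 \<le> m v" "u = (\<Sum>v\<in>W. m v *\<^sub>R (a v - y))"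
    by (auto simp: in_cone_def)
  then have "u = (\<Sum>i\<in>UNIV. m (e i) *\<^sub>R (a (e i) - y))"
    using sum.reindex_bij_betw[OF e, of "\<lambda>v. m v *\<^sub>R (a v - y)"] by simp
  then have "(\<lambda>i. m (e i)) = ($) (f u)" by (rule f(2))
  moreover have "0 \<le> m (e k)" for k using m(1) e by (auto simp: bij_betw_def)
  ultimately show "\<forall>k. 0 \<le> f u $ k" by metis
next
  assume k: "\<forall>k. 0 \<le> f u $ k"
  define m where "m v = f u $ (inv e v)" for v
  have "u = (\<Sum>v\<in>W. m v *\<^sub>R (a v - y))"
    using sum.reindex_bij_betw[OF e, of "\<lambda>v. m v *\<^sub>R (a v - y)"] f(1)[of u] e
    by (simp add: m_def bij_betw_def)
  then show "in_cone a y u W" using k by (auto simp: in_cone_def m_def)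
qed

text \<open>Degenerate images of simplices need no separate treatment: if some facet has a
  nonzero sign, its vertices (relative to \<open>y\<close>) form a basis, and otherwise the sum vanishes.\<close>

lemma facet_sum:
  fixes a :: "'b \<Rightarrow> real^'d::{finite,linorder}"
  assumes fin: "finite V" and card: "card V = CARD('d) + 1" and alt: "alternating_on V ori"
    and y: "\<And>W. W \<subset> V \<Longrightarrow> y \<notin> convex hull (a ` W)"
  shows "\<exists>k. \<bar>k\<bar> \<le> of_bool (y \<in> convex hull (a ` V)) \<and>
    (\<forall>u. (\<forall>W\<subseteq>V. card W < CARD('d) \<longrightarrow> u \<notin> span ((\<lambda>v. a v - y) ` W)) \<longrightarrow>
       (\<Sum>v\<in>V. facet_sign ori a y v (V - {v}) * of_bool (in_cone a y u (V - {v}))) = k)"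
proof (cases "\<forall>v\<in>V. facet_sign ori a y v (V - {v}) = 0")
  case True
  then show ?thesis by (intro exI[of _ 0]) simp
next
  case False
  then obtain v0 where v0: "v0 \<in> V" and nz: "facet_sign ori a y v0 (V - {v0}) \<noteq> 0" by auto
  define ws where "ws = some_order (V - {v0})"
  have ws: "distinct ws" "set ws = V - {v0}"
    using some_order[of "V - {v0}"] fin by (auto simp: ws_def)
  have len: "length ws = CARD('d)"
    using ws card v0 fin by (metis card_Diff_singleton add_diff_cancel_right' distinct_card)
  define e :: "'d \<Rightarrow> 'b" where "e i = ws ! card {..<i}" for i
  have e: "bij_betw e UNIV (V - {v0})"
    using bij_betw_nth_card_lessThan[OF ws(1) len] ws(2) by (simp add: e_def[abs_def])
  then have e_inj: "inj e" and e_im: "range e = V - {v0}" by (auto simp: bij_betw_def)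
  have e_eq: "e i = e j \<longleftrightarrow> i = j" for i j using e_inj by (auto dest: injD)
  have e_v0: "e i \<noteq> v0" "e i \<in> V" for i using e_im by auto
  have V: "V = insert v0 (range e)" using e_im v0 by auto
  have Vi: "V - {e i} = insert v0 (e ` (UNIV - {i}))" for i
    using V e_v0 e_eq by auto
  define X where "X i = a (e i) - y" for i
  define x0 where "x0 = a v0 - y"
  have so0: "real_of_int (standard_orientation (y # map a ws)) = sgn (row_det X)"
    unfolding sgn_standard_orientation using len card_lessThan_less[where ?'d='d]
    by (simp add: X_def[abs_def] e_def)
  have fs0: "facet_sign ori a y v0 (V - {v0}) = ori (v0 # ws) * standard_orientation (y # map a ws)"
    by (simp add: facet_sign_def ws_def)
  have det: "row_det X \<noteq> 0" using nz so0 unfolding fs0 by auto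
  obtain f where f: "\<And>u. u = (\<Sum>i\<in>UNIV. f u $ i *\<^sub>R X i)"
    "\<And>u c. u = (\<Sum>i\<in>UNIV. c i *\<^sub>R X i) \<Longrightarrow> c = ($) (f u)"
    using row_det_coordinates[OF det] by metis
  define c where "c = ($) (f x0)"
  have x0: "x0 = (\<Sum>i\<in>UNIV. c i *\<^sub>R X i)" using f(1)[of x0] by (simp add: c_def)
  define \<sigma> where "\<sigma> = facet_sign ori a y v0 (V - {v0})"
  \<comment> \<open>Exchanging \<open>v0\<close> with \<open>e i\<close> is one transposition of the
    ordered vertices, hence the minus sign. By \<open>row_det_upd\<close> it multiplies the
    determinant by \<open>c i\<close>.\<close>
  have fsi: "real_of_int (facet_sign ori a y (e i) (V - {e i})) = - \<sigma> * sgn (c i)" for i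
  proof -
    let ?p = "card {..<i}"
    let ?ws = "ws[?p := v0]"
    have p: "?p < length ws" using len card_lessThan_less[of i] by simp
    have 1: "distinct (v0 # ws)" "set (v0 # ws) = V" using ws v0 by auto
    have pl: "permute_list (Transposition.transpose 0 (Suc ?p)) (v0 # ws) = e i # ?ws"
    proof (rule nth_equalityI)
      fix k assume k: "k < length (permute_list (Transposition.transpose 0 (Suc ?p)) (v0 # ws))"
      then show "permute_list (Transposition.transpose 0 (Suc ?p)) (v0 # ws) ! k = (e i # ?ws) ! k"
        using p by (cases k)
          (auto simp: permute_list_def Transposition.transpose_def e_def nth_list_update simp del: upt_Suc)
    qed simp
    have perm: "Transposition.transpose 0 (Suc ?p) permutes {..<length (v0 # ws)}"
      using p by (simp add: permutes_swap_id)
    have d: "distinct (e i # ?ws)" "set (e i # ?ws) = V"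
      using perm 1 by (metis distinct_permute_list pl, metis set_permute_list pl)
    have W: "V - {e i} = set ?ws" using d by auto
    have ori: "ori (e i # ?ws) = - ori (v0 # ws)"
      using alternating_on_swap[OF alt 1, of 0 "Suc ?p"] p by (simp add: pl)
    have "(\<lambda>k. map a ?ws ! card {..<k} - y) = X(i := x0)"
      using len p card_lessThan_less[where ?'d='d]
      by (auto simp: X_def e_def x0_def nth_list_update card_lessThan_eq_iff)
    then have so: "real_of_int (standard_orientation (y # map a ?ws)) = sgn (c i) * sgn (row_det X)"
      unfolding sgn_standard_orientation using row_det_upd[of X i c] x0 by (simp add: sgn_mult)
    have "facet_sign ori a y (e i) (V - {e i}) = ori (e i # ?ws) * standard_orientation (y # map a ?ws)"
    proof (rule facet_sign_eq)
      show "alternating_on (insert (e i) (V - {e i})) ori"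
        using alt e_v0(2)[of i] by (simp add: insert_absorb)
      show "card (V - {e i}) = CARD('d)" using card fin e_v0(2)[of i] by simp
    qed (use d W in auto)
    then show ?thesis using so so0 ori by (simp add: \<sigma>_def fs0)
  qed
  have cone0: "in_cone a y u (V - {v0}) \<longleftrightarrow> (\<forall>k. 0 \<le> f u $ k)" for u
    using e by (rule in_cone_iff_coordinates) (simp_all flip: X_def add: f)
  have split: "(\<Sum>v\<in>V - {e i}. m v *\<^sub>R (a v - y))
      = m v0 *\<^sub>R x0 + (\<Sum>j\<in>UNIV - {i}. m (e j) *\<^sub>R X j)" for m :: "'b \<Rightarrow> real" and i
  proof -
    have "(\<Sum>v\<in>V - {e i}. m v *\<^sub>R (a v - y))
      = m v0 *\<^sub>R (a v0 - y) + (\<Sum>v\<in>e ` (UNIV - {i}). m v *\<^sub>R (a v - y))"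
      unfolding Vi using e_v0 by (subst sum.insert) auto
    then show ?thesis
      using inj_on_subset[OF e_inj, of "UNIV - {i}"] by (simp add: sum.reindex X_def x0_def)
  qed
  have expand: "s *\<^sub>R x0 + (\<Sum>j\<in>UNIV - {i}. m j *\<^sub>R X j)
      = (\<Sum>j\<in>UNIV. (s * c j + (if j = i then 0 else m j)) *\<^sub>R X j)" for s m i
    unfolding x0
    by (simp add: scaleR_add_left sum.distrib scaleR_sum_right if_distrib[of "\<lambda>t. t *\<^sub>R _"]
        sum.If_cases Compl_eq_Diff_UNIV cong: if_cong)
  \<comment> \<open>Here \<open>s\<close> is the coefficient at \<open>v0\<close>. Expanding
    \<open>x0\<close> in the basis turns the other coefficients into
    \<open>f u $ k - s * c k\<close>, which vanishes at \<open>i\<close> since \<open>e i\<close> is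
    omitted.\<close>
  have conei: "in_cone a y u (V - {e i}) \<longleftrightarrow> (\<exists>s\<ge>0. f u $ i = s * c i \<and> (\<forall>k. s * c k \<le> f u $ k))" for u i
  proof
    assume "in_cone a y u (V - {e i})"
    then obtain m where m: "\<And>v. v \<in> V - {e i} \<Longrightarrow> 0 \<le> m v" "u = (\<Sum>v\<in>V - {e i}. m v *\<^sub>R (a v - y))"
      by (auto simp: in_cone_def)
    then have "u = (\<Sum>j\<in>UNIV. (m v0 * c j + (if j = i then 0 else m (e j))) *\<^sub>R X j)"
      using split[of m i] expand by simp
    then have fu: "f u $ j = m v0 * c j + (if j = i then 0 else m (e j))" for j
      by (metis f(2))
    have "0 \<le> m v0" using m(1) v0 e_v0 by (metis DiffI singletonD)
    moreover have "0 \<le> m (e j)" if "j \<noteq> i" for j using m(1) that e_v0 e_eq by blast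
    ultimately show "\<exists>s\<ge>0. f u $ i = s * c i \<and> (\<forall>k. s * c k \<le> f u $ k)"
      using fu by (intro exI[of _ "m v0"]) auto
  next
    assume "\<exists>s\<ge>0. f u $ i = s * c i \<and> (\<forall>k. s * c k \<le> f u $ k)"
    then obtain s where s: "0 \<le> s" "f u $ i = s * c i" "\<And>k. s * c k \<le> f u $ k" by auto
    define m where "m v = (if v = v0 then s else f u $ inv e v - s * c (inv e v))" for v
    have "(\<Sum>v\<in>V - {e i}. m v *\<^sub>R (a v - y)) = (\<Sum>j\<in>UNIV. f u $ j *\<^sub>R X j)"
      unfolding split m_def using e_v0 e_inj expand s(2) by (auto intro!: sum.cong)
    then have "u = (\<Sum>v\<in>V - {e i}. m v *\<^sub>R (a v - y))" using f(1) by metis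
    moreover have "\<forall>v\<in>V - {e i}. 0 \<le> m v" using s by (simp add: m_def)
    ultimately show "in_cone a y u (V - {e i})" unfolding in_cone_def by blast
  qed
  have balanced: "0 < s \<Longrightarrow> (\<And>j. j \<noteq> i \<Longrightarrow> 0 \<le> m j) \<Longrightarrow> s *\<^sub>R x0 + (\<Sum>j\<in>UNIV - {i}. m j *\<^sub>R X j) = 0 \<Longrightarrow>
     y \<in> convex hull (a ` (V - {e i}))" for s m i
  proof (rule convex_hull_image_if_balanced[where m="\<lambda>v. if v = v0 then s else m (inv e v)"])
    assume s: "0 < s" "\<And>j. j \<noteq> i \<Longrightarrow> 0 \<le> m j" "s *\<^sub>R x0 + (\<Sum>j\<in>UNIV - {i}. m j *\<^sub>R X j) = 0"
    let ?m = "\<lambda>v. if v = v0 then s else m (inv e v)"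
    show nn: "0 \<le> ?m v" if "v \<in> V - {e i}" for v
    proof -
      have "v = v0 \<or> (\<exists>j. j \<noteq> i \<and> v = e j)" using that unfolding Vi by auto
      then show ?thesis using s(1,2) e_inj by auto
    qed
    have "?m v0 \<le> sum ?m (V - {e i})"
    proof (rule member_le_sum)
      show "v0 \<in> V - {e i}" using v0 e_v0(1)[of i] by simp
      show "0 \<le> ?m x" if "x \<in> V - {e i} - {v0}" for x using nn[of x] that by blast
    qed (use fin in simp)
    then show "0 < sum ?m (V - {e i})" using s by simp
    show "(\<Sum>v\<in>V - {e i}. ?m v *\<^sub>R (a v - y)) = 0"
      unfolding split using s(3) e_v0 e_inj by simp
  qed (use fin in simp)
  \<comment> \<open>If all \<open>c k\<close> are nonpositive and one is 0, then \<open>y\<close> is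
    a convex combination of the facet opposite \<open>e k\<close>, but \<open>y\<close> avoids the
    hulls of proper faces.\<close>
  have H: "c k < 0" if "\<And>k. c k \<le> 0" for k
  proof (rule ccontr)
    assume "\<not> c k < 0"
    then have ck: "c k = 0" using that[of k] by simp
    have "1 *\<^sub>R x0 + (\<Sum>j\<in>UNIV - {k}. (- c j) *\<^sub>R X j) = 0"
      unfolding expand by (rule sum.neutral) (auto simp: ck)
    then have "y \<in> convex hull (a ` (V - {e k}))"
      using balanced[of 1 k "\<lambda>j. - c j"] that by simp
    then show False using y[of "V - {e k}"] e_v0 by auto
  qed
  show ?thesis
  \<comment> \<open>Negative \<open>c k\<close> turn the expansion of \<open>x0\<close> into a
    balanced relation with positive weights, so \<open>y\<close> is in the hull of all images. This
    is the only case in which the crossings do not cancel.\<close>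
  proof (intro exI[of _ "\<sigma> * of_bool (\<forall>k. c k < 0)"] conjI allI impI)
    have "ori (v0 # ws) \<in> {1, -1}"
      using alt ws v0 by (simp add: alternating_on_def insert_absorb)
    then have "\<bar>\<sigma>\<bar> \<le> 1"
      unfolding \<sigma>_def fs0 by (auto simp: abs_mult standard_orientation_def Let_def)
    moreover have "y \<in> convex hull (a ` V)" if "\<forall>k. c k < 0"
    proof -
      have "x0 + (\<Sum>j\<in>UNIV. (- c j) *\<^sub>R X j) = 0" by (subst x0) (simp add: sum_negf)
      moreover have "(\<Sum>v\<in>V. m v *\<^sub>R (a v - y)) = m v0 *\<^sub>R x0 + (\<Sum>j\<in>UNIV. m (e j) *\<^sub>R X j)" for m
        using sum.remove[OF fin v0, of "\<lambda>v. m v *\<^sub>R (a v - y)"]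
          sum.reindex_bij_betw[OF e, of "\<lambda>v. m v *\<^sub>R (a v - y)"] by (simp add: X_def x0_def)
      ultimately have z: "(\<Sum>v\<in>V. (if v = v0 then 1 else - c (inv e v)) *\<^sub>R (a v - y)) = 0"
        using e_v0 e_inj by simp
      show ?thesis
      proof (rule convex_hull_image_if_balanced[OF fin _ _ z])
        show nn: "0 \<le> (if v = v0 then 1 else - c (inv e v))" for v using that by (auto intro: less_imp_le)
        have "(if v0 = v0 then 1 else - c (inv e v0)) \<le> (\<Sum>v\<in>V. (if v = v0 then 1 else - c (inv e v)))"
          by (rule member_le_sum[OF v0 nn fin])
        then show "0 < (\<Sum>v\<in>V. (if v = v0 then 1 else - c (inv e v)))" by simp
      qed
    qed
    ultimately show "\<bar>\<sigma> * of_bool (\<forall>k. c k < 0)\<bar> \<le> of_bool (y \<in> convex hull (a ` V))"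
      by (auto simp: abs_mult)
  next
    fix u assume u: "\<forall>W\<subseteq>V. card W < CARD('d) \<longrightarrow> u \<notin> span ((\<lambda>v. a v - y) ` W)"
    define A where "A = {s. 0 \<le> s \<and> (\<forall>k. s * c k \<le> f u $ k)}"
    \<comment> \<open>At \<open>s = 0\<close> a tight constraint would put \<open>u\<close> in the
      span of \<open>d - 1\<close> vectors; two tight constraints would put it in the span of
      \<open>x0\<close> and \<open>d - 2\<close> of the \<open>X k\<close>. The choice of
      \<open>u\<close> excludes both.\<close>
    have G: "0 < s \<and> (f u $ j = s * c j \<longrightarrow> i = j)"
      if s: "0 \<le> s" "\<And>k. s * c k \<le> f u $ k" "f u $ i = s * c i" for s i j
    proof (rule conjI)
      show "0 < s"
      proof (rule ccontr)
        assume "\<not> 0 < s"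
        then have "f u $ i = 0" using s by simp
        then have "u = (\<Sum>k\<in>UNIV - {i}. f u $ k *\<^sub>R X k)"
          by (subst f(1)) (simp add: sum.remove[of UNIV i])
        moreover have "(\<Sum>k\<in>UNIV - {i}. f u $ k *\<^sub>R X k) \<in> span ((\<lambda>v. a v - y) ` e ` (UNIV - {i}))"
          by (intro span_sum span_scale span_base) (auto simp: X_def)
        moreover have "e ` (UNIV - {i}) \<subseteq> V" "card (e ` (UNIV - {i})) < CARD('d)"
          using e_v0 inj_on_subset[OF e_inj, of "UNIV - {i}"] by (auto simp: card_image)
        ultimately show False using u by metis
      qed
      show "f u $ j = s * c j \<longrightarrow> i = j"
      proof (intro impI, rule ccontr)
        assume j: "f u $ j = s * c j" "i \<noteq> j"
        have "u = (\<Sum>k\<in>UNIV. f u $ k *\<^sub>R X k)" by (rule f(1))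
        also have "\<dots> = s *\<^sub>R x0 + (\<Sum>k\<in>UNIV - {i}. (f u $ k - s * c k) *\<^sub>R X k)"
          unfolding expand using s(3) by (intro sum.cong) auto
        also have "(\<Sum>k\<in>UNIV - {i}. (f u $ k - s * c k) *\<^sub>R X k)
            = (\<Sum>k\<in>UNIV - {i} - {j}. (f u $ k - s * c k) *\<^sub>R X k)"
          using j by (subst sum.remove[of _ j]) auto
        finally have "u = s *\<^sub>R x0 + (\<Sum>k\<in>UNIV - {i} - {j}. (f u $ k - s * c k) *\<^sub>R X k)" .
        moreover let ?W = "insert v0 (e ` (UNIV - {i} - {j}))"
        have "s *\<^sub>R x0 + (\<Sum>k\<in>UNIV - {i} - {j}. (f u $ k - s * c k) *\<^sub>R X k)
            \<in> span ((\<lambda>v. a v - y) ` ?W)"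
          by (intro span_add span_sum span_scale span_base) (auto simp: X_def x0_def)
        moreover have "?W \<subseteq> V" using e_v0 v0 by auto
        moreover have "card ?W < CARD('d)"
        proof -
          have "card (e ` (UNIV - {i} - {j})) \<le> card (UNIV - {i} - {j})"
            by (rule card_image_le) simp
          also have "\<dots> = CARD('d) - 2" using j by (simp add: card_Diff_singleton)
          finally have "card ?W \<le> Suc (CARD('d) - 2)" by (simp add: card_insert_if)
          \<comment> \<open>Distinct \<open>i\<close> and \<open>j\<close> force dimension at least
            2, so \<open>CARD('d) - 2\<close> is not truncated.\<close>
          moreover have "card {i, j} \<le> CARD('d)" by (rule card_mono) auto
          ultimately show ?thesis using j by auto
        qed
        ultimately show False using u by metis
      qed
    qed
    have re: "of_bool (0 \<in> A) - (\<Sum>i\<in>UNIV. sgn (c i) * of_bool (c i \<noteq> 0 \<and> f u $ i / c i \<in> A))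
           = (of_bool (\<forall>k. c k < 0) :: real)"
      by (rule ray_endpoints[OF G H A_def])
    have hit0: "in_cone a y u (V - {v0}) \<longleftrightarrow> 0 \<in> A" unfolding cone0 A_def by simp
    \<comment> \<open>For nonzero \<open>c i\<close> the tight constraint determines
      \<open>s\<close>; if \<open>c i = 0\<close>, the facet has sign 0 and its term
      vanishes.\<close>
    have hiti: "in_cone a y u (V - {e i}) \<longleftrightarrow> f u $ i / c i \<in> A" if "c i \<noteq> 0" for i
    proof -
      have "f u $ i = s * c i \<longleftrightarrow> s = f u $ i / c i" for s using that by (auto simp: field_simps)
      then show ?thesis unfolding conei A_def by auto
    qed
    let ?t = "\<lambda>v. facet_sign ori a y v (V - {v}) * of_bool (in_cone a y u (V - {v}))"
    have "real_of_int (\<Sum>v\<in>V. ?t v) = real_of_int (?t v0) + (\<Sum>v\<in>V - {v0}. real_of_int (?t v))"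
      using sum.remove[OF fin v0, of ?t] by simp
    also have "(\<Sum>v\<in>V - {v0}. real_of_int (?t v)) = (\<Sum>i\<in>UNIV. real_of_int (?t (e i)))"
      by (rule sum.reindex_bij_betw[OF e, symmetric])
    also have "\<dots> = (\<Sum>i\<in>UNIV. - \<sigma> * (sgn (c i) * of_bool (c i \<noteq> 0 \<and> f u $ i / c i \<in> A)))"
    proof (rule sum.cong)
      show "real_of_int (?t (e i)) = - \<sigma> * (sgn (c i) * of_bool (c i \<noteq> 0 \<and> f u $ i / c i \<in> A))" for i
        using fsi[of i] hiti[of i] by (cases "c i = 0") auto
    qed simp
    also have "\<dots> = - \<sigma> * (\<Sum>i\<in>UNIV. sgn (c i) * of_bool (c i \<noteq> 0 \<and> f u $ i / c i \<in> A))"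
      by (rule sum_distrib_left[symmetric])
    also have "real_of_int (?t v0) + \<dots> = \<sigma> * (of_bool (\<forall>k. c k < 0) :: real)"
      unfolding re[symmetric] hit0 \<sigma>_def by (simp add: algebra_simps)
    finally have "real_of_int (\<Sum>v\<in>V. ?t v) = real_of_int (\<sigma> * of_bool (\<forall>k. c k < 0))" by simp
    then show "(\<Sum>v\<in>V. ?t v) = \<sigma> * of_bool (\<forall>k. c k < 0)" by (simp only: of_int_eq_iff)
  qed
qed

section \<open>Cofacets and the boundary of a triangulated manifold\<close>

lemma simplex_vertices_convex_hull:
  fixes C :: "'b::euclidean_space set"
  assumes "\<not> affine_dependent C"
  shows "simplex_vertices (convex hull C) = C"
  using assms by (auto simp: simplex_vertices_def extreme_point_of_convex_hull_affine_independent)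

lemma simplex_vertices:
  fixes S :: "'b::euclidean_space set"
  assumes "n simplex S"
  shows "\<not> affine_dependent (simplex_vertices S)" "finite (simplex_vertices S)"
    "int (card (simplex_vertices S)) = n + 1" "convex hull (simplex_vertices S) = S"
proof -
  obtain C where "\<not> affine_dependent C" "int (card C) = n + 1" "S = convex hull C"
    using assms by (auto simp: simplex_def)
  then show "\<not> affine_dependent (simplex_vertices S)" "finite (simplex_vertices S)"
    "int (card (simplex_vertices S)) = n + 1" "convex hull (simplex_vertices S) = S"
    using simplex_vertices_convex_hull[of C] aff_independent_finite by auto
qed

lemma complex_simplex_vertices:
  fixes S :: "'b::euclidean_space set"
  assumes "simplicial_complex T" "S \<in> T"
  shows "\<not> affine_dependent (simplex_vertices S)" "finite (simplex_vertices S)"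
    "convex hull (simplex_vertices S) = S"
  using assms simplex_vertices unfolding simplicial_complex_def by metis+

lemma simplex_iff_card_vertices:
  fixes S :: "'b::euclidean_space set"
  assumes "simplicial_complex T" "S \<in> T"
  shows "n simplex S \<longleftrightarrow> int (card (simplex_vertices S)) = n + 1"
  using simplex_vertices(3) complex_simplex_vertices[OF assms] unfolding simplex_def by metis

lemma complex_subsimplex:
  fixes S :: "'b::euclidean_space set"
  assumes "simplicial_complex T" "S \<in> T" "W \<subseteq> simplex_vertices S"
  shows "convex hull W \<in> T" "simplex_vertices (convex hull W) = W" "convex hull W face_of S"
proof -
  note S = complex_simplex_vertices[OF assms(1,2)]
  show "convex hull W face_of S"
    using face_of_convex_hull_affine_independent[OF S(1)] S(3) assms(3) by metis
  then show "convex hull W \<in> T"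
    using assms unfolding simplicial_complex_def by blast
  show "simplex_vertices (convex hull W) = W"
    using simplex_vertices_convex_hull affine_independent_subset S(1) assms(3) by blast
qed

text \<open>\<open>S \<inter> F\<close> is a face of \<open>F\<close> that meets the relative
  interior of \<open>F\<close>, hence is all of \<open>F\<close>.\<close>

lemma complex_face_if_meets_rel_interior:
  fixes S F :: "'b::euclidean_space set"
  assumes T: "simplicial_complex T" and "S \<in> T" "F \<in> T" "x \<in> rel_interior F" "x \<in> S"
  shows "F face_of S" "simplex_vertices F \<subseteq> simplex_vertices S"
proof -
  have SF: "(S \<inter> F) face_of S" "(F \<inter> S) face_of F"
    using assms by (simp_all add: simplicial_complex_def)
  have "F \<subseteq> F \<inter> S"
    using subset_of_face_of[OF SF(2), of F] assms rel_interior_subset[of F] by auto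
  then show face: "F face_of S" using SF(1) by (metis Int_absorb1 Int_subset_iff)
  then show "simplex_vertices F \<subseteq> simplex_vertices S"
    using extreme_point_of_face[OF face] by (auto simp: simplex_vertices_def)
qed

text \<open>The intersection is a face of both simplices, so it is spanned by a subset of either
  vertex set. A simplex determines its vertices, so the two subsets coincide.\<close>

lemma complex_Int_vertices:
  fixes S S' :: "'b::euclidean_space set"
  assumes T: "simplicial_complex T" and S: "S \<in> T" and S': "S' \<in> T"
  shows "S \<inter> S' = convex hull (simplex_vertices S \<inter> simplex_vertices S')"
proof
  have "(S \<inter> S') face_of S" "(S' \<inter> S) face_of S'"
    using assms by (simp_all add: simplicial_complex_def)
  then obtain c c' where c: "c \<subseteq> simplex_vertices S" "S \<inter> S' = convex hull c"
    and c': "c' \<subseteq> simplex_vertices S'" "S \<inter> S' = convex hull c'"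
    using face_of_convex_hull_affine_independent complex_simplex_vertices[OF T] S S'
    by (metis Int_commute)
  then have "c = c'" using complex_subsimplex(2)[OF T] S S' by metis
  then show "S \<inter> S' \<subseteq> convex hull (simplex_vertices S \<inter> simplex_vertices S')"
    using c c' by (simp add: hull_mono)
  show "convex hull (simplex_vertices S \<inter> simplex_vertices S') \<subseteq> S \<inter> S'"
    using hull_mono[of "simplex_vertices S \<inter> simplex_vertices S'"] complex_simplex_vertices(3)[OF T] S S'
    by (metis Int_lower1 Int_lower2 Int_subset_iff)
qed

text \<open>A cofacet is recorded by its apex, which determines it; prepending the apex to an
  ordering of the facet gives an ordering of the cofacet.\<close>

definition cofacet_vertices :: "nat \<Rightarrow> 'b::euclidean_space set set \<Rightarrow> 'b set \<Rightarrow> 'b set" where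
  "cofacet_vertices d T F = {v. \<exists>S\<in>T. int d simplex S \<and> simplex_vertices S = insert v (simplex_vertices F)
      \<and> v \<notin> simplex_vertices F}"

text \<open>Each vertex of \<open>S\<close> outside \<open>F\<close> spans with \<open>F\<close> a
  \<open>d\<close>-simplex that is a face of \<open>S\<close>. So the cofacets of \<open>F\<close>
  control every simplex, of whatever dimension, through a relative interior point of
  \<open>F\<close>.\<close>

lemma star_vertices:
  fixes S F :: "'b::euclidean_space set"
  assumes T: "simplicial_complex T" and "S \<in> T" "F \<in> T" "x \<in> rel_interior F" "x \<in> S"
    and F: "(int d - 1) simplex F"
  shows "simplex_vertices F \<subseteq> simplex_vertices S"
    "simplex_vertices S - simplex_vertices F \<subseteq> cofacet_vertices d T F"
proof -
  show sub: "simplex_vertices F \<subseteq> simplex_vertices S"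
    using complex_face_if_meets_rel_interior assms by blast
  show "simplex_vertices S - simplex_vertices F \<subseteq> cofacet_vertices d T F"
  proof
    fix v assume v: "v \<in> simplex_vertices S - simplex_vertices F"
    let ?S = "convex hull (insert v (simplex_vertices F))"
    have S: "?S \<in> T" "simplex_vertices ?S = insert v (simplex_vertices F)"
      using complex_subsimplex[OF T assms(2), of "insert v (simplex_vertices F)"] sub v by auto
    then have "int d simplex ?S"
      using simplex_vertices(2,3)[OF F] v by (simp add: simplex_iff_card_vertices[OF T])
    then show "v \<in> cofacet_vertices d T F" unfolding cofacet_vertices_def using S v by blast
  qed
qed

section \<open>Interior and boundary points in charts\<close>

lemma star_nbhd:
  fixes T :: "'b::euclidean_space set set"
  assumes T: "simplicial_complex T"
  obtains G where "open G" "x \<in> G" "\<And>S y. S \<in> T \<Longrightarrow> y \<in> G \<Longrightarrow> y \<in> S \<Longrightarrow> x \<in> S"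
proof
  have "closed S" if "S \<in> T" for S
    using complex_simplex_vertices(2,3)[OF T that]
    by (metis compact_imp_closed finite_imp_compact_convex_hull)
  moreover have "finite T" using T by (simp add: simplicial_complex_def)
  ultimately show "open (- \<Union>{S\<in>T. x \<notin> S})" by (intro open_Compl closed_Union) auto
qed auto

text \<open>Invariance of domain: \<open>\<phi>\<close> after \<open>k\<close> injects a relatively
  open set of dimension \<open>d\<close> into the affine hull of \<open>D\<close>, of the same
  dimension, so the image is relatively open. The parameters have their own space \<open>'c\<close>,
  because two simplices folded along a facet will be parametrized from a product with a
  line.\<close>

lemma chart_interior:
  fixes M :: "'b::euclidean_space set" and k :: "'c::euclidean_space \<Rightarrow> 'b"
  assumes chart: "pl_chart_at d M x U D \<phi>" and A: "affine A" "aff_dim A = int d"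
    and Q: "openin (top_of_set A) Q" "q \<in> Q" and k: "continuous_on Q k" "inj_on k Q" "k ` Q \<subseteq> M" "k q = x"
  shows "\<phi> x \<in> rel_interior D"
proof -
  obtain \<psi> where UM: "U \<subseteq> M" and x: "x \<in> top_of_set M interior_of U" and D: "int d simplex D"
    and hom: "homeomorphism U D \<phi> \<psi>"
    using chart by (auto simp: pl_chart_at_def)
  obtain G where G: "open G" "x \<in> G" "M \<inter> G \<subseteq> U"
    using x by (auto simp: interior_of_def openin_open)
  define Q' where "Q' = Q \<inter> k -` G"
  have "openin (top_of_set Q) Q'"
    unfolding Q'_def using k(1) G(1) by (rule continuous_openin_preimage_gen)
  then have Q': "openin (top_of_set A) Q'" using Q(1) openin_trans by blast
  have kU: "k ` Q' \<subseteq> U" using G k(3) by (auto simp: Q'_def)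
  have "continuous_on Q' (\<phi> \<circ> k)"
    using k(1) kU homeomorphism_cont1[OF hom]
    by (intro continuous_on_compose) (auto intro: continuous_on_subset simp: Q'_def)
  moreover have "inj_on (\<phi> \<circ> k) Q'"
  proof (rule inj_onI)
    fix b b' assume b: "b \<in> Q'" "b' \<in> Q'" "(\<phi> \<circ> k) b = (\<phi> \<circ> k) b'"
    then have "k b \<in> U" "k b' \<in> U" using kU by auto
    then have "k b = k b'" using b(3) homeomorphism_apply1[OF hom] by (metis comp_apply)
    then show "b = b'" using k(2) b(1,2) by (auto simp: Q'_def inj_on_def)
  qed
  moreover have im: "(\<phi> \<circ> k) ` Q' \<subseteq> D" using kU hom by (auto simp: homeomorphism_def)
  moreover have "\<phi> \<circ> k \<in> Q' \<rightarrow> affine hull D"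
    using hull_inc[OF subsetD[OF im imageI]] by blast
  moreover have "aff_dim (affine hull D) \<le> aff_dim A"
    using D A by (simp add: aff_dim_simplex)
  ultimately have "openin (top_of_set (affine hull D)) ((\<phi> \<circ> k) ` Q')"
    using A by (intro invariance_of_domain_affine_sets[OF Q']) auto
  then have "(\<phi> \<circ> k) ` Q' \<subseteq> rel_interior D" using im rel_interior_maximal by blast
  then show ?thesis using Q(2) G(2) k(4) by (auto simp: Q'_def)
qed

text \<open>The boundary asks for some chart that sends \<open>x\<close> to the frontier, while
  \<open>chart_interior\<close> speaks of every chart at \<open>x\<close>. So one parametrization
  settles the matter.\<close>

lemma not_manifold_boundary:
  fixes M :: "'b::euclidean_space set" and k :: "'c::euclidean_space \<Rightarrow> 'b"
  assumes "affine A" "aff_dim A = int d" "openin (top_of_set A) Q" "q \<in> Q"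
    "continuous_on Q k" "inj_on k Q" "k ` Q \<subseteq> M" "k q = x"
  shows "x \<notin> manifold_boundary d M"
  using chart_interior[OF _ assms] by (auto simp: manifold_boundary_def rel_frontier_def)

text \<open>A chart that sends \<open>x\<close> into the relative interior of \<open>D\<close> does
  so for nearby points, and its inverse parametrizes \<open>M\<close> around each of them. This
  serves to pass from the relative interior of a facet to the whole facet.\<close>

lemma not_manifold_boundary_open:
  fixes M :: "'b::euclidean_space set"
  assumes M: "compact_pl_manifold d M" and x: "x \<in> M" "x \<notin> manifold_boundary d M"
  obtains G where "open G" "x \<in> G" "G \<inter> manifold_boundary d M = {}"
proof -
  obtain U D \<phi> where chart: "pl_chart_at d M x U D \<phi>"
    using M x by (auto simp: compact_pl_manifold_def)
  then obtain \<psi> where UM: "U \<subseteq> M" and xU: "x \<in> top_of_set M interior_of U" and D: "int d simplex D"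
    and hom: "homeomorphism U D \<phi> \<psi>" by (auto simp: pl_chart_at_def)
  obtain G where G: "open G" "x \<in> G" "M \<inter> G \<subseteq> U"
    using xU by (auto simp: interior_of_def openin_open)
  have xU': "x \<in> U" using G x by auto
  have ri: "openin (top_of_set (affine hull D)) (rel_interior D)" by (rule openin_rel_interior)
  then have "openin (top_of_set D) (rel_interior D)"
    by (metis hull_subset openin_subset_trans rel_interior_subset)
  then have "openin (top_of_set U) (U \<inter> \<phi> -` rel_interior D)"
    using hom by (metis continuous_on_imp_continuous_within continuous_openin_preimage homeomorphism_cont1 homeomorphism_image1 image_subset_iff_funcset order_refl)
  then obtain H where H: "open H" "U \<inter> \<phi> -` rel_interior D = U \<inter> H"
    by (auto simp: openin_open)
  have "\<phi> x \<in> D" using xU' hom by (auto simp: homeomorphism_def)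
  then have "\<phi> x \<in> rel_interior D"
    using x chart by (auto simp: manifold_boundary_def rel_frontier_def dest: subsetD[OF closure_subset])
  then have "x \<in> H" using H xU' by auto
  have "z \<notin> manifold_boundary d M" if z: "z \<in> G" "z \<in> H" for z
  proof (cases "z \<in> M")
    case True
    then have zU: "z \<in> U" using G z by auto
    show ?thesis
    proof (rule not_manifold_boundary[OF _ _ ri])
      show "\<phi> z \<in> rel_interior D" using H zU z by auto
      show "continuous_on (rel_interior D) \<psi>"
        using homeomorphism_cont2[OF hom] rel_interior_subset continuous_on_subset by blast
      show "inj_on \<psi> (rel_interior D)"
        using homeomorphism_apply2[OF hom] rel_interior_subset[of D] by (intro inj_on_inverseI[of _ \<phi>]) auto
      show "\<psi> ` rel_interior D \<subseteq> M"
        using homeomorphism_image2[OF hom] image_mono[OF rel_interior_subset[of D], of \<psi>] UM by simp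
      show "\<psi> (\<phi> z) = z" using hom zU by (auto simp: homeomorphism_def)
      show "aff_dim (affine hull D) = int d" using D by (simp add: aff_dim_simplex)
    qed simp
  qed (auto simp: manifold_boundary_def)
  then show ?thesis
    using that[of "G \<inter> H"] G(1,2) H(1) \<open>x \<in> H\<close> by auto
qed

text \<open>Near a relative interior point of a facet without cofacets, the polyhedron would lie in
  that facet. By invariance of dimension, a set of dimension \<open>d - 1\<close> cannot receive an
  open piece of a \<open>d\<close>-simplex.\<close>

lemma cofacet_exists:
  fixes T :: "'b::euclidean_space set set"
  assumes T: "simplicial_complex T" and M: "compact_pl_manifold d (\<Union>T)"
    and F: "F \<in> T" "(int d - 1) simplex F" and d: "0 < d"
  shows "cofacet_vertices d T F \<noteq> {}"
proof
  assume none: "cofacet_vertices d T F = {}"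
  have cF: "convex F" using simplex_vertices(4)[OF F(2)] by (metis convex_convex_hull)
  \<comment> \<open>For \<open>d = 0\<close> the facet would be the empty simplex, of dimension
    -1.\<close>
  have "F \<noteq> {}" using F(2) d aff_dim_simplex[OF F(2)] by (auto simp: aff_dim_empty_eq)
  then obtain x where x: "x \<in> rel_interior F" using cF rel_interior_eq_empty by blast
  then have xF: "x \<in> F" using rel_interior_subset by blast
  have star: "S = F" if "S \<in> T" "x \<in> S" for S
  proof -
    have "simplex_vertices S = simplex_vertices F"
      using star_vertices[OF T that(1) F(1) x that(2) F(2)] none by auto
    then show ?thesis using complex_simplex_vertices(3)[OF T] that F by metis
  qed
  obtain G where G: "open G" "x \<in> G" "\<And>S y. S \<in> T \<Longrightarrow> y \<in> G \<Longrightarrow> y \<in> S \<Longrightarrow> x \<in> S"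
    using star_nbhd[OF T] by blast
  have GF: "G \<inter> \<Union>T \<subseteq> F" using G(3) star by blast
  obtain U D \<phi> where "pl_chart_at d (\<Union>T) x U D \<phi>"
    using M xF F(1) unfolding compact_pl_manifold_def by blast
  then obtain \<psi> where UM: "U \<subseteq> \<Union>T" and xU: "x \<in> top_of_set (\<Union>T) interior_of U"
    and D: "int d simplex D" and hom: "homeomorphism U D \<phi> \<psi>"
    by (auto simp: pl_chart_at_def)
  have xU': "x \<in> U" using xU interior_of_subset[of "top_of_set (\<Union>T)" U] by auto
  have "openin (top_of_set D) (D \<inter> \<psi> -` G)"
    using homeomorphism_cont2[OF hom] G(1) by (rule continuous_openin_preimage_gen)
  then obtain H where H: "open H" "D \<inter> \<psi> -` G = D \<inter> H" by (auto simp: openin_open)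
  have "convex D" using simplex_vertices(4)[OF D] by (metis convex_convex_hull)
  have "\<phi> x \<in> D" "\<psi> (\<phi> x) = x" using xU' hom by (auto simp: homeomorphism_def)
  then have "\<phi> x \<in> H" using H(2) G(2) by auto
  \<comment> \<open>\<open>\<phi> x\<close> may be on the frontier of \<open>D\<close>, so the open
    piece is taken close to it inside \<open>rel_interior D\<close>.\<close>
  moreover have "\<phi> x \<in> closure (rel_interior D)"
    using \<open>\<phi> x \<in> D\<close> closure_subset convex_closure_rel_interior[OF \<open>convex D\<close>] by blast
  ultimately have ne: "rel_interior D \<inter> H \<noteq> {}"
    using H(1) by (metis Int_commute IntI empty_iff open_Int_closure_eq_empty)
  have sub: "rel_interior D \<inter> H \<subseteq> D" using rel_interior_subset by blast
  have "aff_dim (affine hull D) \<le> aff_dim (affine hull F)"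
  proof (rule invariance_of_dimension_affine_sets[OF _ _ _ _ _ _ ne])
    show "openin (top_of_set (affine hull D)) (rel_interior D \<inter> H)"
      using openin_rel_interior H(1) by (rule openin_Int_open)
    show "continuous_on (rel_interior D \<inter> H) \<psi>"
      using homeomorphism_cont2[OF hom] sub continuous_on_subset by blast
    show "inj_on \<psi> (rel_interior D \<inter> H)"
      using homeomorphism_apply2[OF hom] sub by (intro inj_on_inverseI[of _ \<phi>]) auto
    show "\<psi> \<in> rel_interior D \<inter> H \<rightarrow> affine hull F"
    proof
      fix e assume e: "e \<in> rel_interior D \<inter> H"
      then have "e \<in> D" "\<psi> e \<in> G" using sub H(2) by auto
      then have "\<psi> e \<in> F" using GF UM hom by (auto simp: homeomorphism_def)
      then show "\<psi> e \<in> affine hull F" by (rule hull_inc)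
    qed
  qed auto
  then show False using aff_dim_simplex[OF D] aff_dim_simplex[OF F(2)] by simp
qed

text \<open>If the multiples differed, the equation could be solved for \<open>p\<close>, which
  would put \<open>p\<close> in \<open>H\<close>. So \<open>p - x\<close> gives a coordinate
  transversal to \<open>H\<close>.\<close>

lemma affine_offset_unique:
  assumes "affine H" "p \<notin> H" "x \<in> H" "b \<in> H" "b' \<in> H" "b + r *\<^sub>R (p - x) = b' + r' *\<^sub>R (p - x)"
  shows "r = r'" "b = b'"
proof -
  have e: "(r - r') *\<^sub>R (p - x) = b' - b" using assms(6) by (simp add: algebra_simps)
  show "r = r'"
  proof (rule ccontr)
    assume "r \<noteq> r'"
    then have "p - x = (1 / (r - r')) *\<^sub>R (b' - b)" by (simp flip: e)
    then have "p = x + (1 / (r - r')) *\<^sub>R (b' - b)" by (simp add: algebra_simps)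
    then show False using mem_affine_3_minus[OF assms(1,3,5,4)] assms(2) by metis
  qed
  then show "b = b'" using assms(6) by simp
qed

text \<open>Two simplices folded along \<open>F\<close> contain a parametrized piece of dimension
  \<open>d\<close> through a relative interior point of \<open>F\<close>. An injection into the
  polyhedron is enough, so the argument tolerates further cofacets.\<close>

lemma two_cofacets_not_boundary:
  fixes T :: "'b::euclidean_space set set"
  assumes T: "simplicial_complex T"
    and F: "F \<in> T" "(int d - 1) simplex F" and d: "0 < d"
    and v: "v \<in> cofacet_vertices d T F" and w: "w \<in> cofacet_vertices d T F" and vw: "v \<noteq> w"
  shows "\<not> F \<subseteq> manifold_boundary d (\<Union>T)"
proof -
  let ?V = "simplex_vertices F"
  note V = simplex_vertices[OF F(2)]
  obtain S where S: "S \<in> T" "simplex_vertices S = insert v ?V" "v \<notin> ?V"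
    using v by (auto simp: cofacet_vertices_def)
  obtain S' where S': "S' \<in> T" "simplex_vertices S' = insert w ?V" "w \<notin> ?V"
    using w by (auto simp: cofacet_vertices_def)
  have cF: "convex F" by (metis convex_convex_hull V(4))
  have "F \<noteq> {}" using d aff_dim_simplex[OF F(2)] by (auto simp: aff_dim_empty_eq)
  then obtain x where x: "x \<in> rel_interior F" using cF rel_interior_eq_empty by blast
  then have xF: "x \<in> F" using rel_interior_subset by blast
  define H where "H = affine hull F"
  have H: "affine H" "x \<in> H" by (simp_all add: H_def xF hull_inc)
  have off: "p \<notin> H" if "\<not> affine_dependent (insert p ?V)" "p \<notin> ?V" for p
    using that unfolding affine_dependent_def H_def
    by (metis Diff_insert_absorb V(4) affine_hull_convex_hull insertI1)
  have vH: "v \<notin> H" and wH: "w \<notin> H"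
    using off S S' complex_simplex_vertices(1)[OF T] by metis+
  have int: "S \<inter> S' \<subseteq> H"
  proof -
    have "simplex_vertices S \<inter> simplex_vertices S' = ?V" using S S' vw by auto
    then have "S \<inter> S' = F" using complex_Int_vertices[OF T S(1) S'(1)] V(4) by simp
    then show ?thesis by (simp add: H_def hull_subset)
  qed
  obtain e where e: "0 < e" "ball x e \<inter> H \<subseteq> F"
    using x unfolding H_def by (auto simp: mem_rel_interior_ball)
  define L where "L = (+) (- x) ` H"
  have L: "l \<in> L \<longleftrightarrow> x + l \<in> H" for l unfolding L_def by (auto simp: image_iff algebra_simps)
  have subL: "subspace L" unfolding L_def using H by (rule affine_diffs_subspace[of H x])
  have "aff_dim L = aff_dim H" unfolding L_def by (rule aff_dim_translation_eq)
  then have "aff_dim L = int d - 1" using aff_dim_simplex[OF F(2)] by (simp add: H_def)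
  then have dimL: "int (dim L) = int d - 1" using aff_dim_subspace[OF subL] by simp
  define A where "A = L \<times> (UNIV :: real set)"
  have subA: "subspace A" unfolding A_def using subL by (simp add: subspace_Times)
  have "dim A = dim L + 1" unfolding A_def using subL by (simp add: dim_Times)
  then have A: "affine A" "aff_dim A = int d"
    using dimL subA by (auto simp: aff_dim_subspace subspace_imp_affine)
  \<comment> \<open>\<open>k\<close> flattens the union of the two simplices near \<open>x\<close>: the sign of \<open>r\<close> selects the simplex.\<close>
  define k :: "'b \<times> real \<Rightarrow> 'b" where
    "k = (\<lambda>(l, r). x + l + max r 0 *\<^sub>R (v - x) + max (- r) 0 *\<^sub>R (w - x))"
  have kp: "k (l, r) = x + l + r *\<^sub>R (v - x)" if "0 \<le> r" for l r
    using that by (simp add: k_def)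
  have kn: "k (l, r) = x + l + (- r) *\<^sub>R (w - x)" if "r \<le> 0" for l r
    using that by (simp add: k_def max_def)
  \<comment> \<open>For \<open>0 \<le> r < 1/2\<close> and \<open>norm l < e/2\<close>, the point
    \<open>x + l/(1 - r)\<close> is within \<open>e\<close> of \<open>x\<close>, hence in
    \<open>F\<close>; the image under \<open>k\<close> is a convex combination of such a point and
    an apex.\<close>
  define Q where "Q = A \<inter> (ball 0 (e/2) \<times> {- (1/2) <..< 1/2})"
  have half: "x + l + r *\<^sub>R (p - x) \<in> S0"
    if "l \<in> L" "norm l < e/2" "0 \<le> r" "r < 1/2" "convex S0" "F \<subseteq> S0" "p \<in> S0" for l r p S0
  proof -
    have "x + (1 / (1 - r)) *\<^sub>R l \<in> H"
      using subL that(1) L subspace_scale by blast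
    moreover have "norm ((1 / (1 - r)) *\<^sub>R l) < e"
    proof -
      have "e * (1/2) \<le> e * (1 - r)" using that e(1) by (intro mult_left_mono) auto
      then have "norm l < e * (1 - r)" using that by simp
      then show ?thesis using that by (simp add: field_simps)
    qed
    ultimately have "x + (1 / (1 - r)) *\<^sub>R l \<in> S0"
      using e(2) that(6) by (auto simp: dist_norm subset_iff)
    then have "(1 - r) *\<^sub>R (x + (1 / (1 - r)) *\<^sub>R l) + r *\<^sub>R p \<in> S0"
      using that convexD_alt[OF that(5), of "x + (1 / (1 - r)) *\<^sub>R l" p r] by simp
    moreover have "(1 - r) *\<^sub>R (x + (1 / (1 - r)) *\<^sub>R l) + r *\<^sub>R p = x + l + r *\<^sub>R (p - x)"
      using that by (simp add: algebra_simps)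
    ultimately show ?thesis by simp
  qed
  have FS: "F \<subseteq> S" "v \<in> S" "convex S" "F \<subseteq> S'" "w \<in> S'" "convex S'"
    using complex_simplex_vertices(3)[OF T] S S' V(4)
    by (metis hull_mono subset_insertI, metis hull_inc insertI1, metis convex_convex_hull,
        metis hull_mono subset_insertI, metis hull_inc insertI1, metis convex_convex_hull)
  have inS: "k (l, r) \<in> S" if "(l, r) \<in> Q" "0 \<le> r" for l r
    unfolding kp[OF that(2)] using that half[of l r S v] FS by (auto simp: Q_def A_def)
  have inS': "k (l, r) \<in> S'" if "(l, r) \<in> Q" "r \<le> 0" for l r
    unfolding kn[OF that(2)] using that half[of l "- r" S' w] FS by (auto simp: Q_def A_def)
  have "x \<notin> manifold_boundary d (\<Union>T)"
  proof (rule not_manifold_boundary[OF A])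
    show "openin (top_of_set A) Q"
      unfolding Q_def by (intro openin_open_Int open_Times) auto
    show "(0, 0) \<in> Q" using e(1) subL by (auto simp: Q_def A_def subspace_0)
    show "continuous_on Q k"
      unfolding k_def case_prod_beta by (intro continuous_intros)
    show "k ` Q \<subseteq> \<Union>T"
    proof
      fix z assume "z \<in> k ` Q"
      then obtain l r where "z = k (l, r)" "(l, r) \<in> Q" by auto
      then show "z \<in> \<Union>T" using inS[of l r] inS'[of l r] S(1) S'(1) by (cases "0 \<le> r") auto
    qed
    show "k (0, 0) = x" by (simp add: k_def)
    \<comment> \<open>A common value of the two halves lies in \<open>S \<inter> S'\<close>, hence
      in \<open>H\<close>, which forces the coefficient of \<open>v - x\<close> to be 0.\<close>
    have mixed: False if "(l, r) \<in> Q" "(l', r') \<in> Q" "k (l, r) = k (l', r')" "0 < r" "r' < 0" for l r l' r'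
    proof -
      have "k (l, r) \<in> H" using inS[of l r] inS'[of l' r'] that int by auto
      moreover have "x + l \<in> H" using that L by (auto simp: Q_def A_def)
      ultimately have "r = 0"
        using affine_offset_unique(1)[OF H(1) vH H(2), of "x + l" "k (l, r)" r 0] that kp by simp
      then show False using that by simp
    qed
    show "inj_on k Q"
    proof (rule inj_onI)
      fix p p' assume Q: "p \<in> Q" "p' \<in> Q" and eq: "k p = k p'"
      obtain l r l' r' where p: "p = (l, r)" "p' = (l', r')" by (cases p, cases p')
      have lH: "x + l \<in> H" "x + l' \<in> H" using Q L by (auto simp: Q_def A_def p)
      consider "0 \<le> r" "0 \<le> r'" | "r \<le> 0" "r' \<le> 0" | "0 < r" "r' < 0" | "r < 0" "0 < r'" by linarith
      then show "p = p'"
      proof cases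
        case 1
        then show ?thesis
          using affine_offset_unique[OF H(1) vH H(2) lH, of r r'] eq by (simp add: p kp)
      next
        case 2
        then show ?thesis
          using affine_offset_unique[OF H(1) wH H(2) lH, of "- r" "- r'"] eq by (simp add: p kn)
      next
        case 3 then show ?thesis using mixed Q eq by (simp add: p)
      next
        case 4 then show ?thesis using mixed[of l' r' l r] Q eq by (simp add: p)
      qed
    qed
  qed
  then show ?thesis using xF by auto
qed

text \<open>Near a relative interior point of \<open>F\<close> the polyhedron is just the cofacet
  \<open>S\<close>, so the identity of \<open>S\<close> is a chart there, and it sends
  \<open>F\<close> to the frontier of \<open>S\<close>.\<close>

lemma one_cofacet_boundary:
  fixes T :: "'b::euclidean_space set set"
  assumes T: "simplicial_complex T" and M: "compact_pl_manifold d (\<Union>T)"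
    and F: "F \<in> T" "(int d - 1) simplex F" and v: "cofacet_vertices d T F = {v}"
  shows "F \<subseteq> manifold_boundary d (\<Union>T)"
proof -
  note V = simplex_vertices[OF F(2)]
  obtain S where S: "S \<in> T" "int d simplex S" "simplex_vertices S = insert v (simplex_vertices F)"
    "v \<notin> simplex_vertices F"
    using v by (auto simp: cofacet_vertices_def)
  have FS: "F face_of S" using complex_subsimplex(3)[OF T S(1), of "simplex_vertices F"] S(3) V(4) by auto
  have "F \<noteq> S" using S(3,4) by auto
  then have Ffr: "F \<subseteq> rel_frontier S" using FS face_of_subset_rel_frontier by blast
  have cF: "convex F" by (metis convex_convex_hull V(4))
  \<comment> \<open>\<open>pl_map_on\<close> asks for a complex with union exactly \<open>S\<close>;
    the faces of \<open>S\<close> provide it.\<close>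
  define K where "K = {F \<in> T. F face_of S}"
  have "simplicial_complex K"
    unfolding simplicial_complex_def K_def
  proof (intro conjI ballI allI impI)
    show "finite {F \<in> T. F face_of S}" using T by (simp add: simplicial_complex_def)
    show "\<exists>n. n simplex A" if "A \<in> {F \<in> T. F face_of S}" for A
      using T that by (auto simp: simplicial_complex_def)
    show "B \<in> {F \<in> T. F face_of S}" if "A \<in> {F \<in> T. F face_of S} \<and> B face_of A" for A B
    proof -
      have "A \<in> T" "A face_of S" "B face_of A" using that by auto
      then show ?thesis using T face_of_trans[of B A S] by (auto simp: simplicial_complex_def)
    qed
    show "(A \<inter> B) face_of A" if "A \<in> {F \<in> T. F face_of S} \<and> B \<in> {F \<in> T. F face_of S}" for A B
      using T that by (simp add: simplicial_complex_def)
  qed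
  moreover have "\<Union>K = S"
  proof -
    have "convex S" by (metis convex_convex_hull simplex_vertices(4)[OF S(2)])
    then have "S \<in> K" using S(1) by (simp add: K_def face_of_refl)
    then show ?thesis using face_of_imp_subset by (auto simp: K_def)
  qed
  ultimately have pl: "pl_map_on S id"
    unfolding pl_map_on_def by (intro exI[of _ K]) (auto simp: affine_map_on_def)
  have ri: "x \<in> manifold_boundary d (\<Union>T)" if x: "x \<in> rel_interior F" for x
  proof -
    have xF: "x \<in> F" using x rel_interior_subset by blast
    have star: "S' \<subseteq> S" if "S' \<in> T" "x \<in> S'" for S'
    proof -
      have "simplex_vertices S' \<subseteq> simplex_vertices S"
        using star_vertices[OF T that(1) F(1) x that(2) F(2)] v S(3) by auto
      then show ?thesis using complex_simplex_vertices(3)[OF T] that S(1) by (metis hull_mono)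
    qed
    obtain G where G: "open G" "x \<in> G" "\<And>S y. S \<in> T \<Longrightarrow> y \<in> G \<Longrightarrow> y \<in> S \<Longrightarrow> x \<in> S"
      using star_nbhd[OF T] by blast
    have "\<Union>T \<inter> G \<subseteq> S" using G(3) star by blast
    then have "x \<in> top_of_set (\<Union>T) interior_of S"
      using G xF F(1) unfolding interior_of_def by (auto simp: openin_open)
    then have "pl_chart_at d (\<Union>T) x S S id"
      unfolding pl_chart_at_def using S(1,2) pl
      by (auto intro!: exI[of _ id] simp: homeomorphism_def)
    then show ?thesis
      unfolding manifold_boundary_def using Ffr xF F(1) by fastforce
  qed
  \<comment> \<open>The chart covers only the relative interior of \<open>F\<close>. A non-boundary
    point of \<open>F\<close> would have a neighbourhood free of boundary points, but relative
    interior points accumulate at it.\<close>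
  show ?thesis
  proof
    fix x assume x: "x \<in> F"
    show "x \<in> manifold_boundary d (\<Union>T)"
    proof (rule ccontr)
      assume "x \<notin> manifold_boundary d (\<Union>T)"
      then obtain G where G: "open G" "x \<in> G" "G \<inter> manifold_boundary d (\<Union>T) = {}"
        using not_manifold_boundary_open[OF M] x F(1) by blast
      have "x \<in> closure (rel_interior F)"
        using x closure_subset convex_closure_rel_interior[OF cF] by blast
      then have "G \<inter> rel_interior F \<noteq> {}"
        using G(1,2) by (metis IntI empty_iff open_Int_closure_eq_empty)
      then show False using ri G(3) by blast
    qed
  qed
qed

section \<open>Simplicial maps and orientations\<close>

lemma alternating_on_simplex:
  assumes "compatible_orientation d T ori" "S \<in> T" "int d simplex S"
  shows "alternating_on (simplex_vertices S) ori"
  using assms by (auto simp: compatible_orientation_def alternating_on_def orders_simplex_def)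

lemma cofacet_orientation:
  assumes co: "compatible_orientation d T ori"
    and v: "v \<in> cofacet_vertices d T F" and w: "w \<in> cofacet_vertices d T F" and "v \<noteq> w"
    and vs: "distinct vs" "set vs = simplex_vertices F"
  shows "ori (w # vs) = - ori (v # vs)" "ori (v # vs) \<noteq> 0"
proof -
  obtain S where S: "S \<in> T" "int d simplex S" "orders_simplex (v # vs) S"
    using v vs by (auto simp: cofacet_vertices_def orders_simplex_def)
  obtain S' where S': "S' \<in> T" "int d simplex S'" "orders_simplex (w # vs) S'"
    using w vs by (auto simp: cofacet_vertices_def orders_simplex_def)
  show "ori (w # vs) = - ori (v # vs)"
    using co S S' \<open>v \<noteq> w\<close> unfolding compatible_orientation_def by blast
  have "ori (v # vs) \<in> {1, -1}"
    using co S unfolding compatible_orientation_def by blast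
  then show "ori (v # vs) \<noteq> 0" by auto
qed

lemma induced_orientation_cofacet:
  assumes F: "cofacet_vertices d T F = {v}" and vs: "distinct vs" "set vs = simplex_vertices F"
  shows "induced_orientation d T ori vs = ori (v # vs)"
proof -
  have "(\<exists>S\<in>T. int d simplex S \<and> orders_simplex (w # vs) S) \<longleftrightarrow> w \<in> cofacet_vertices d T F" for w
    using vs by (auto simp: cofacet_vertices_def orders_simplex_def)
  then show ?thesis by (simp add: induced_orientation_def F)
qed

lemma finite_cofacet_vertices:
  assumes "simplicial_complex T"
  shows "finite (cofacet_vertices d T F)"
proof (rule finite_subset)
  show "cofacet_vertices d T F \<subseteq> (\<Union>S\<in>T. simplex_vertices S)"
    by (auto simp: cofacet_vertices_def)
  show "finite (\<Union>S\<in>T. simplex_vertices S)"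
    using assms complex_simplex_vertices(2)[OF assms] by (auto simp: simplicial_complex_def)
qed

text \<open>This uniqueness gives the definite description in \<open>induced_orientation\<close> its
  meaning.\<close>

lemma boundary_facet_cofacet:
  fixes T :: "'b::euclidean_space set set"
  assumes T: "simplicial_complex T" and M: "compact_pl_manifold d (\<Union>T)" and d: "0 < d"
    and F: "F \<in> boundary_complex d T" "(int d - 1) simplex F"
  obtains v where "cofacet_vertices d T F = {v}"
proof -
  have F': "F \<in> T" "F \<subseteq> manifold_boundary d (\<Union>T)" using F(1) by (auto simp: boundary_complex_def)
  obtain v where v: "v \<in> cofacet_vertices d T F"
    using cofacet_exists[OF T M F'(1) F(2) d] by auto
  then have "cofacet_vertices d T F = {v}"
    using two_cofacets_not_boundary[OF T F'(1) F(2) d v] F'(2) by auto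
  then show ?thesis by (rule that)
qed

text \<open>Pairs of a \<open>d\<close>-simplex and a vertex correspond to pairs of a facet and a
  cofacet apex. Since \<open>g\<close> depends on the facet alone, opposite orientations cancel at
  inner facets.\<close>

lemma sum_facets_eq_sum_boundary:
  fixes T :: "'b::euclidean_space set set" and g :: "'b set \<Rightarrow> int"
  assumes T: "simplicial_complex T" and M: "compact_pl_manifold d (\<Union>T)" and d: "0 < d"
    and co: "compatible_orientation d T ori"
  shows "(\<Sum>S | S \<in> T \<and> int d simplex S. \<Sum>v\<in>simplex_vertices S.
            ori (v # some_order (simplex_vertices S - {v})) * g (simplex_vertices S - {v}))
       = (\<Sum>F | F \<in> boundary_complex d T \<and> (int d - 1) simplex F.
            induced_orientation d T ori (some_order (simplex_vertices F)) * g (simplex_vertices F))"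
    (is "?lhs = ?rhs")
proof -
  let ?sv = simplex_vertices
  let ?h = "\<lambda>W v. ori (v # some_order W) * g W"
  define DS where "DS = {S. S \<in> T \<and> int d simplex S}"
  define FS where "FS = {F. F \<in> T \<and> (int d - 1) simplex F}"
  have finT: "finite T" using T by (simp add: simplicial_complex_def)
  note T_vert = complex_simplex_vertices[OF T]
  have "?lhs = (\<Sum>(S, v)\<in>(SIGMA S:DS. ?sv S). ?h (?sv S - {v}) v)"
    unfolding DS_def[symmetric] using finT T_vert(2) by (subst sum.Sigma) (auto simp: DS_def)
  also have "\<dots> = (\<Sum>(F, v)\<in>(SIGMA F:FS. cofacet_vertices d T F). ?h (?sv F) v)"
  proof (rule sum.reindex_bij_witness[where
        i="\<lambda>(F, v). (convex hull (insert v (?sv F)), v)" and j="\<lambda>(S, v). (convex hull (?sv S - {v}), v)"])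
    fix p assume "p \<in> (SIGMA S:DS. ?sv S)"
    then obtain S v where p: "p = (S, v)" and S: "S \<in> T" "int d simplex S" and v: "v \<in> ?sv S"
      by (auto simp: DS_def)
    let ?F = "convex hull (?sv S - {v})"
    have F: "?F \<in> T" "?sv ?F = ?sv S - {v}" using complex_subsimplex[OF T S(1), of "?sv S - {v}"] by auto
    have ins: "insert v (?sv S - {v}) = ?sv S" using v by auto
    show "(\<lambda>(F, v). (convex hull (insert v (?sv F)), v)) ((\<lambda>(S, v). (convex hull (?sv S - {v}), v)) p) = p"
      using T_vert(3)[OF S(1)] F(2) ins by (simp add: p)
    have "int (card (?sv ?F)) = int d"
      using simplex_vertices(2,3)[OF S(2)] v d unfolding F(2) by (simp add: card_Diff_singleton)
    then have "(int d - 1) simplex ?F" using F(1) by (simp add: simplex_iff_card_vertices[OF T])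
    moreover have "v \<in> cofacet_vertices d T ?F"
      unfolding cofacet_vertices_def F(2) using S ins by blast
    ultimately show "(\<lambda>(S, v). (convex hull (?sv S - {v}), v)) p \<in> (SIGMA F:FS. cofacet_vertices d T F)"
      using F(1) by (simp add: p FS_def)
    show "(\<lambda>(F, v). ?h (?sv F) v) ((\<lambda>(S, v). (convex hull (?sv S - {v}), v)) p)
        = (\<lambda>(S, v). ?h (?sv S - {v}) v) p"
      by (simp add: p F(2))
  next
    fix p assume "p \<in> (SIGMA F:FS. cofacet_vertices d T F)"
    then obtain F v where p: "p = (F, v)" and F: "F \<in> T" "(int d - 1) simplex F"
      and v: "v \<in> cofacet_vertices d T F" by (auto simp: FS_def)
    then obtain S where S: "S \<in> T" "int d simplex S" "?sv S = insert v (?sv F)" "v \<notin> ?sv F"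
      by (auto simp: cofacet_vertices_def)
    have hull: "convex hull (insert v (?sv F)) = S" using T_vert(3)[OF S(1)] S(3) by simp
    show "(\<lambda>(F, v). (convex hull (insert v (?sv F)), v)) p \<in> (SIGMA S:DS. ?sv S)"
      using S hull by (auto simp: p DS_def)
    show "(\<lambda>(S, v). (convex hull (?sv S - {v}), v)) ((\<lambda>(F, v). (convex hull (insert v (?sv F)), v)) p) = p"
      using S hull T_vert(3)[OF F(1)] by (simp add: p)
  qed
  also have "\<dots> = (\<Sum>F\<in>FS. \<Sum>v\<in>cofacet_vertices d T F. ?h (?sv F) v)"
    using finT finite_cofacet_vertices[OF T] by (subst sum.Sigma) (auto simp: FS_def)
  also have "\<dots> = (\<Sum>F\<in>FS. if F \<in> boundary_complex d T
      then induced_orientation d T ori (some_order (?sv F)) * g (?sv F) else 0)"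
  proof (rule sum.cong[OF refl])
    fix F assume "F \<in> FS"
    then have F: "F \<in> T" "(int d - 1) simplex F" by (auto simp: FS_def)
    have so: "distinct (some_order (?sv F))" "set (some_order (?sv F)) = ?sv F"
      using some_order[OF T_vert(2)[OF F(1)]] by auto
    obtain v where v: "v \<in> cofacet_vertices d T F" using cofacet_exists[OF T M F d] by auto
    show "(\<Sum>v\<in>cofacet_vertices d T F. ?h (?sv F) v) = (if F \<in> boundary_complex d T
      then induced_orientation d T ori (some_order (?sv F)) * g (?sv F) else 0)"
    proof (cases "cofacet_vertices d T F = {v}")
      case True
      then have "F \<in> boundary_complex d T"
        using one_cofacet_boundary[OF T M F] F(1) by (simp add: boundary_complex_def)
      then show ?thesis using True induced_orientation_cofacet[OF True so] by simp
    next
      case False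
      then obtain w where w: "w \<in> cofacet_vertices d T F" "v \<noteq> w" using v by auto
      note o = cofacet_orientation[OF co _ _ _ so]
      \<comment> \<open>Three cofacets would have pairwise opposite signs.\<close>
      have "u = v \<or> u = w" if u: "u \<in> cofacet_vertices d T F" for u
      proof (rule ccontr)
        assume n: "\<not> (u = v \<or> u = w)"
        show False
          using o(1)[OF v w] o(1)[OF v u] o(1)[OF w(1) u] o(2)[OF v w] n by fastforce
      qed
      then have "cofacet_vertices d T F = {v, w}" using v w by auto
      then have "(\<Sum>v\<in>cofacet_vertices d T F. ?h (?sv F) v) = 0"
        using w(2) o(1)[OF v w] by simp
      moreover have "F \<notin> boundary_complex d T"
        using two_cofacets_not_boundary[OF T F d v w] by (simp add: boundary_complex_def)
      ultimately show ?thesis by simp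
    qed
  qed
  also have "\<dots> = ?rhs"
    using finT by (subst sum.inter_filter[symmetric])
      (auto simp: FS_def boundary_complex_def intro!: sum.cong)
  finally show ?thesis .
qed

section \<open>Simplicial maps in barycentric coordinates\<close>

lemma simplicial_map_eq:
  fixes T :: "'b::euclidean_space set set" and a :: "'b \<Rightarrow> 'v::real_vector"
  assumes T: "simplicial_complex T" and S: "S \<in> T"
    and u: "\<And>v. v \<in> simplex_vertices S \<Longrightarrow> 0 \<le> u v" "sum u (simplex_vertices S) = 1"
  shows "simplicial_map T a (\<Sum>v\<in>simplex_vertices S. u v *\<^sub>R v) = (\<Sum>v\<in>simplex_vertices S. u v *\<^sub>R a v)"
proof -
  let ?sv = simplex_vertices
  note T_vert = complex_simplex_vertices[OF T]
  \<comment> \<open>Affine independence forces \<open>u\<close> to vanish off \<open>C\<close> and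
    to agree with \<open>t\<close> on \<open>C\<close>. With \<open>C\<close> the common vertices of
    two simplices, the map is well defined on overlaps.\<close>
  have uniq: "(\<Sum>v\<in>?sv S. u v *\<^sub>R a v) = (\<Sum>v\<in>C. t v *\<^sub>R a v)"
    if S: "S \<in> T" and C: "C \<subseteq> ?sv S" and u: "sum u (?sv S) = 1" and t: "sum t C = 1"
      and eq: "(\<Sum>v\<in>?sv S. u v *\<^sub>R v) = (\<Sum>v\<in>C. t v *\<^sub>R v)" for S C u t
  proof -
    let ?t = "\<lambda>v. if v \<in> C then t v else 0"
    have fin: "finite (?sv S)" using T_vert(2) S by blast
    have ext: "(\<Sum>v\<in>?sv S. ?t v *\<^sub>R x v) = (\<Sum>v\<in>C. t v *\<^sub>R x v)" for x :: "'b \<Rightarrow> 'w::real_vector"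
      using C fin by (intro sum.mono_neutral_cong_right) auto
    have "sum ?t (?sv S) = 1"
      using sum.mono_neutral_cong_right[OF fin C, of ?t t] t by simp
    then have "(\<Sum>v\<in>?sv S. u v - ?t v) = 0" using u by (simp add: sum_subtractf)
    moreover have "(\<Sum>v\<in>?sv S. (u v - ?t v) *\<^sub>R v) = 0"
      using eq ext[of "\<lambda>v. v"] by (simp add: scaleR_diff_left sum_subtractf)
    ultimately have "affine_dependent (?sv S)" if "\<exists>v\<in>?sv S. u v - ?t v \<noteq> 0"
      unfolding affine_dependent_explicit_finite[OF fin]
      using that by (intro exI[of _ "\<lambda>v. u v - ?t v"] conjI)
    then have "\<forall>v\<in>?sv S. u v - ?t v = 0" using T_vert(1)[OF S] by blast
    then have "u v = ?t v" if "v \<in> ?sv S" for v using that by simp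
    then have "(\<Sum>v\<in>?sv S. u v *\<^sub>R a v) = (\<Sum>v\<in>?sv S. ?t v *\<^sub>R a v)" by simp
    then show ?thesis using ext by simp
  qed
  show ?thesis unfolding simplicial_map_def
  proof (rule the_equality)
    show "\<exists>S'\<in>T. \<exists>u'. (\<forall>v\<in>?sv S'. 0 \<le> u' v) \<and> sum u' (?sv S') = 1 \<and>
        (\<Sum>v\<in>?sv S. u v *\<^sub>R v) = (\<Sum>v\<in>?sv S'. u' v *\<^sub>R v) \<and>
        (\<Sum>v\<in>?sv S. u v *\<^sub>R a v) = (\<Sum>v\<in>?sv S'. u' v *\<^sub>R a v)"
      using u by (intro bexI[OF _ S] exI[of _ u]) auto
  next
    fix z assume "\<exists>S'\<in>T. \<exists>u'. (\<forall>v\<in>?sv S'. 0 \<le> u' v) \<and> sum u' (?sv S') = 1 \<and>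
        (\<Sum>v\<in>?sv S. u v *\<^sub>R v) = (\<Sum>v\<in>?sv S'. u' v *\<^sub>R v) \<and> z = (\<Sum>v\<in>?sv S'. u' v *\<^sub>R a v)"
    then obtain S' u' where S': "S' \<in> T" and u': "\<forall>v\<in>?sv S'. 0 \<le> u' v" "sum u' (?sv S') = 1"
      and eq: "(\<Sum>v\<in>?sv S. u v *\<^sub>R v) = (\<Sum>v\<in>?sv S'. u' v *\<^sub>R v)" and z: "z = (\<Sum>v\<in>?sv S'. u' v *\<^sub>R a v)"
      by blast
    let ?x = "\<Sum>v\<in>?sv S. u v *\<^sub>R v" and ?C = "?sv S \<inter> ?sv S'"
    have "?x \<in> convex hull (?sv S)"
      using u T_vert(2)[OF S] unfolding convex_hull_finite[OF T_vert(2)[OF S]] by blast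
    moreover have "?x \<in> convex hull (?sv S')"
      unfolding eq using u' unfolding convex_hull_finite[OF T_vert(2)[OF S']] by blast
    ultimately have "?x \<in> convex hull ?C"
      using complex_Int_vertices[OF T S S'] T_vert(3) S S' by auto
    moreover have "finite ?C" using T_vert(2)[OF S] by simp
    ultimately obtain t where t: "sum t ?C = 1" "(\<Sum>v\<in>?C. t v *\<^sub>R v) = ?x"
      unfolding convex_hull_finite[OF \<open>finite ?C\<close>] by blast
    have "(\<Sum>v\<in>?sv S. u v *\<^sub>R a v) = (\<Sum>v\<in>?C. t v *\<^sub>R a v)"
      by (rule uniq[OF S]) (use u t in auto)
    moreover have "(\<Sum>v\<in>?sv S'. u' v *\<^sub>R a v) = (\<Sum>v\<in>?C. t v *\<^sub>R a v)"
      by (rule uniq[OF S']) (use u' t eq in auto)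
    ultimately show "z = (\<Sum>v\<in>?sv S. u v *\<^sub>R a v)" using z by simp
  qed
qed

lemma simplicial_map_vertex:
  fixes T :: "'b::euclidean_space set set"
  assumes T: "simplicial_complex T" and S: "S \<in> T" "v \<in> simplex_vertices S"
  shows "simplicial_map T a v = a v"
proof -
  have V: "convex hull {v} \<in> T" "simplex_vertices (convex hull {v}) = {v}"
    using complex_subsimplex[OF T S(1), of "{v}"] S(2) by auto
  show ?thesis using simplicial_map_eq[OF T V(1), of "\<lambda>_. 1" a] unfolding V(2) by simp
qed

text \<open>The coefficients are indexed by vertices rather than by their images, since
  \<open>a\<close> may identify vertices.\<close>

lemma simplicial_map_image:
  fixes T :: "'b::euclidean_space set set" and a :: "'b \<Rightarrow> 'v::real_vector"
  assumes T: "simplicial_complex T" and S: "S \<in> T"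
  shows "simplicial_map T a ` S = {z. \<exists>u. (\<forall>v\<in>simplex_vertices S. 0 \<le> u v) \<and>
     sum u (simplex_vertices S) = 1 \<and> z = (\<Sum>v\<in>simplex_vertices S. u v *\<^sub>R a v)}" (is "_ = ?R")
proof -
  let ?V = "simplex_vertices S"
  have S_mem: "x \<in> S \<longleftrightarrow> (\<exists>u. (\<forall>v\<in>?V. 0 \<le> u v) \<and> sum u ?V = 1 \<and> (\<Sum>v\<in>?V. u v *\<^sub>R v) = x)" for x
  proof -
    have "x \<in> S \<longleftrightarrow> x \<in> convex hull ?V" by (simp add: complex_simplex_vertices(3)[OF T S])
    then show ?thesis
      unfolding convex_hull_finite[OF complex_simplex_vertices(2)[OF T S]] by simp
  qed
  show ?thesis
  proof (intro set_eqI iffI)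
    fix z assume "z \<in> simplicial_map T a ` S"
    then obtain x where x: "x \<in> S" "z = simplicial_map T a x" by blast
    obtain u where u: "\<forall>v\<in>?V. 0 \<le> u v" "sum u ?V = 1" "(\<Sum>v\<in>?V. u v *\<^sub>R v) = x"
      using x(1) unfolding S_mem by blast
    then have "z = (\<Sum>v\<in>?V. u v *\<^sub>R a v)" using simplicial_map_eq[OF T S, of u a] x(2) by simp
    then show "z \<in> ?R" using u by blast
  next
    fix z assume "z \<in> ?R"
    then obtain u where u: "\<forall>v\<in>?V. 0 \<le> u v" "sum u ?V = 1" "z = (\<Sum>v\<in>?V. u v *\<^sub>R a v)" by blast
    then have "z = simplicial_map T a (\<Sum>v\<in>?V. u v *\<^sub>R v)"
      using simplicial_map_eq[OF T S, of u a] by simp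
    moreover have "(\<Sum>v\<in>?V. u v *\<^sub>R v) \<in> S" unfolding S_mem using u by blast
    ultimately show "z \<in> simplicial_map T a ` S" by blast
  qed
qed

text \<open>The points \<open>ws\<close> are in a supporting hyperplane, so whether the determinant vanishes does not depend
  on the interior point, and its sign is constant by connectedness.\<close>

lemma frontier_orientation_eq:
  fixes P :: "(real^'d::{finite,linorder}) set"
  assumes P: "convex P" "closed P" and y: "y \<in> interior P"
    and ws: "length ws = CARD('d)" "convex hull (set ws) \<subseteq> frontier P"
  shows "frontier_orientation P ws = standard_orientation (y # ws)"
proof -
  define g where "g q = row_det (\<lambda>i. ws ! card {..<i} - q)" for q
  have mem: "ws ! card {..<i} \<in> set ws" for i :: 'd
    using ws(1) card_lessThan_less[of i] by simp
  have "interior P \<inter> convex hull (set ws) = {}" using ws(2) by (auto simp: frontier_def)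
  moreover have "convex hull (set ws) \<noteq> {}" using mem by auto
  ultimately obtain c b where c: "c \<noteq> 0" and le: "\<And>x. x \<in> interior P \<Longrightarrow> c \<bullet> x \<le> b"
    and ge: "\<And>x. x \<in> convex hull (set ws) \<Longrightarrow> b \<le> c \<bullet> x"
    using separating_hyperplane_sets[of "interior P" "convex hull (set ws)"] y P(1)
    by (metis convex_convex_hull convex_interior empty_iff)
  have "interior P \<subseteq> {x. c \<bullet> x \<le> b}" using le by auto
  then have "interior P \<subseteq> interior {x. c \<bullet> x \<le> b}" by (intro interior_maximal) auto
  then have lt: "c \<bullet> x < b" if "x \<in> interior P" for x using that c by (auto simp: interior_halfspace_le)
  \<comment> \<open>As \<open>P\<close> is the closure of its interior, the separating hyperplane
    supports \<open>P\<close>; the points \<open>ws\<close> belong to \<open>P\<close> and to the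
    other side, so they lie on it.\<close>
  have "closure (interior P) \<subseteq> {x. c \<bullet> x \<le> b}"
    using le by (intro closure_minimal closed_halfspace_le) auto
  moreover have "closure (interior P) = P"
    using convex_closure_interior[OF P(1)] y P(2) by auto
  ultimately have "c \<bullet> w = b" if "w \<in> set ws" for w
    using ge[OF hull_inc[OF that]] hull_inc[OF that] ws(2) P(2) that
    by (metis antisym frontier_subset_closed mem_Collect_eq subsetD)
  then have cw: "c \<bullet> (ws ! card {..<i}) = b" for i :: 'd using mem by blast
  \<comment> \<open>Pairing a relation among the vectors \<open>w - q\<close> with the normal
    \<open>c\<close> shows that its coefficients sum to 0, since all \<open>w\<close> have height
    \<open>b\<close> and \<open>q\<close> is strictly lower. So \<open>q\<close> drops out of the
    relation.\<close>
  have transfer: "g q' = 0" if q: "q \<in> interior P" and g: "g q = 0" for q q'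
  proof -
    obtain \<beta> :: "'d \<Rightarrow> real" where \<beta>: "(\<Sum>i\<in>UNIV. \<beta> i *\<^sub>R (ws ! card {..<i} - q)) = 0" "\<exists>i. \<beta> i \<noteq> 0"
      using g row_det_nonzero_iff unfolding g_def by blast
    have "0 = c \<bullet> (\<Sum>i\<in>UNIV. \<beta> i *\<^sub>R (ws ! card {..<i} - q))" using \<beta>(1) by simp
    also have "\<dots> = sum \<beta> UNIV * (b - c \<bullet> q)"
      by (simp add: inner_sum_right inner_diff_right cw sum_distrib_right)
    finally have "sum \<beta> UNIV = 0" using lt[OF q] by simp
    moreover have "(\<Sum>i\<in>UNIV. \<beta> i *\<^sub>R (ws ! card {..<i} - q'))
       = (\<Sum>i\<in>UNIV. \<beta> i *\<^sub>R (ws ! card {..<i} - q)) + sum \<beta> UNIV *\<^sub>R (q - q')"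
      by (simp add: scaleR_sum_left flip: sum.distrib scaleR_add_right)
    ultimately have "(\<Sum>i\<in>UNIV. \<beta> i *\<^sub>R (ws ! card {..<i} - q')) = 0" using \<beta>(1) by simp
    then show ?thesis
      using row_det_nonzero_iff[of "\<lambda>i. ws ! card {..<i} - q'"] \<beta>(2) unfolding g_def by blast
  qed
  have "continuous_on (interior P) g"
    unfolding g_def row_det_def det_def by (simp, intro continuous_intros)
  then have conn: "connected (g ` interior P)"
    using P(1) by (intro connected_continuous_image convex_connected convex_interior)
  have "sgn (g q) = sgn (g y)" if q: "q \<in> interior P" for q
  proof (cases "g y = 0")
    case True then show ?thesis using transfer[OF y] by simp
  next
    case False
    have "0 \<notin> g ` interior P" using transfer False by force
    then have "\<not> (g q \<le> 0 \<and> 0 \<le> g y)" "\<not> (g y \<le> 0 \<and> 0 \<le> g q)"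
      using connectedD_interval[OF conn] q y by blast+
    then show ?thesis by (auto simp: sgn_if)
  qed
  then have "standard_orientation (q # ws) = standard_orientation (y # ws)" if "q \<in> interior P" for q
  proof -
    have "real_of_int (standard_orientation (q # ws)) = real_of_int (standard_orientation (y # ws))"
      if "sgn (g q) = sgn (g y)"
      using that by (simp add: sgn_standard_orientation g_def)
    then show ?thesis using \<open>\<And>q. q \<in> interior P \<Longrightarrow> sgn (g q) = sgn (g y)\<close>[OF that]
      by (simp only: of_int_eq_iff)
  qed
  then show ?thesis unfolding frontier_orientation_def
    using y by (intro the_equality ballI) (assumption, metis)
qed

section \<open>The degree\<close>

lemma open_avoids_negligible:
  fixes Q :: "'a::euclidean_space set"
  assumes "open Q" "Q \<noteq> {}" "finite \<N>" "\<And>N. N \<in> \<N> \<Longrightarrow> negligible N"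
  obtains x where "x \<in> Q" "\<And>N. N \<in> \<N> \<Longrightarrow> x \<notin> N"
proof -
  have "negligible (\<Union>\<N>)" using assms(3,4) by (intro negligible_Union) auto
  then have "\<not> Q \<subseteq> \<Union>\<N>" using open_not_negligible[OF assms(1,2)] negligible_subset by blast
  then show ?thesis using that by blast
qed

lemma convex_hull_image_subset_simplicial_map:
  fixes T :: "'b::euclidean_space set set" and a :: "'b \<Rightarrow> 'v::real_vector"
  assumes T: "simplicial_complex T" and S: "S \<in> T"
  shows "convex hull (a ` simplex_vertices S) \<subseteq> simplicial_map T a ` S"
proof (rule hull_minimal)
  show "a ` simplex_vertices S \<subseteq> simplicial_map T a ` S"
  proof
    fix w assume "w \<in> a ` simplex_vertices S"
    then obtain v where v: "v \<in> simplex_vertices S" "w = a v" by blast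
    then have "v \<in> S" using complex_simplex_vertices(3)[OF T S] hull_inc by metis
    then show "w \<in> simplicial_map T a ` S"
      using simplicial_map_vertex[OF T S v(1), of a] v(2) by (metis imageI)
  qed
  show "convex (simplicial_map T a ` S)"
    unfolding simplicial_map_image[OF T S]
  proof (rule convexI, clarsimp)
    fix s t :: real and u u' :: "'b \<Rightarrow> real"
    assume "0 \<le> s" "0 \<le> t" "s + t = 1" "\<forall>v\<in>simplex_vertices S. 0 \<le> u v" "\<forall>v\<in>simplex_vertices S. 0 \<le> u' v"
      "sum u (simplex_vertices S) = 1" "sum u' (simplex_vertices S) = 1"
    then show "\<exists>w. (\<forall>v\<in>simplex_vertices S. 0 \<le> w v) \<and> sum w (simplex_vertices S) = 1 \<and>
        s *\<^sub>R (\<Sum>v\<in>simplex_vertices S. u v *\<^sub>R a v) + t *\<^sub>R (\<Sum>v\<in>simplex_vertices S. u' v *\<^sub>R a v)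
        = (\<Sum>v\<in>simplex_vertices S. w v *\<^sub>R a v)"
      by (intro exI[of _ "\<lambda>v. s * u v + t * u' v"])
        (auto simp: sum.distrib scaleR_add_left scaleR_sum_right simp flip: sum_distrib_left)
  qed
qed

text \<open>Evaluating the outward orientation at the chosen interior point \<open>y\<close>
  identifies the local degree on a boundary facet with its crossing sign as seen from
  \<open>y\<close>.\<close>

lemma simplex_sign_eq_facet_sign:
  fixes P :: "(real^'d::{finite,linorder}) set" and T :: "'b::euclidean_space set set"
  assumes P: "convex P" "closed P" and y: "y \<in> interior P"
    and T: "simplicial_complex T" and co: "compatible_orientation CARD('d) T ori"
    and F: "F \<in> T" "(int CARD('d) - 1) simplex F" and v: "cofacet_vertices CARD('d) T F = {v}"
    and fr: "simplicial_map T a ` F \<subseteq> frontier P"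
  shows "simplex_sign T ori P (simplicial_map T a) F = facet_sign ori a y v (simplex_vertices F)"
proof -
  let ?V = "simplex_vertices F"
  obtain S where S: "S \<in> T" "int CARD('d) simplex S" "simplex_vertices S = insert v ?V" "v \<notin> ?V"
    using v by (auto simp: cofacet_vertices_def)
  have alt: "alternating_on (insert v ?V) ori" using alternating_on_simplex[OF co S(1,2)] S(3) by simp
  have card: "card ?V = CARD('d)" using simplex_vertices(3)[OF F(2)] by simp
  have *: "induced_orientation CARD('d) T ori vs * frontier_orientation P (map (simplicial_map T a) vs)
      = facet_sign ori a y v ?V" if "orders_simplex vs F" for vs
  proof -
    have vs: "distinct vs" "set vs = ?V" using that by (auto simp: orders_simplex_def)
    have map: "map (simplicial_map T a) vs = map a vs"
      using simplicial_map_vertex[OF T F(1), of _ a] vs(2) by auto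
    have "length (map a vs) = CARD('d)" using vs card by (metis distinct_card length_map)
    moreover have "convex hull set (map a vs) \<subseteq> frontier P"
      using convex_hull_image_subset_simplicial_map[OF T F(1), of a] fr vs(2) by auto
    ultimately have "frontier_orientation P (map a vs) = standard_orientation (y # map a vs)"
      by (rule frontier_orientation_eq[OF P y])
    then show ?thesis
      using facet_sign_eq[OF alt S(4) vs card] induced_orientation_cofacet[OF v vs] map by metis
  qed
  have "orders_simplex (some_order ?V) F"
    using some_order[OF simplex_vertices(2)[OF F(2)]] by (simp add: orders_simplex_def)
  then show ?thesis unfolding simplex_sign_def
    using * by (intro the_equality) blast+
qed

text \<open>If the ray towards \<open>z\<close> hits the facet, regularity makes all coordinates of
  \<open>z - y\<close> positive; if it misses, some coordinate is negative. Both conditions are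
  open. By \<open>nz\<close> the vectors \<open>a v - y\<close> form a basis, so there are
  coordinates.\<close>

lemma eventually_in_cone_iff:
  fixes P :: "(real^'d::{finite,linorder}) set" and T :: "'b::euclidean_space set set"
    and a :: "'b \<Rightarrow> real^'d::{finite,linorder}"
  assumes P: "convex P" "closed P" and y: "y \<in> interior P"
    and T: "simplicial_complex T"
    and F: "F \<in> boundary_complex CARD('d) T" "(int CARD('d) - 1) simplex F"
    and fr: "simplicial_map T a ` F \<subseteq> frontier P"
    and z: "z \<in> regular_values T P (simplicial_map T a)"
    and nz: "standard_orientation (y # map a (some_order (simplex_vertices F))) \<noteq> 0"
  shows "eventually (\<lambda>u. in_cone a y u (simplex_vertices F) \<longleftrightarrow> z \<in> simplicial_map T a ` F) (nhds (z - y))"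
proof -
  let ?V = "simplex_vertices F" and ?h = "simplicial_map T a"
  have FT: "F \<in> T" using F(1) by (simp add: boundary_complex_def)
  have finV: "finite ?V" and cardV: "card ?V = CARD('d)" using simplex_vertices(2,3)[OF F(2)] by simp_all
  have zP: "z \<in> frontier P" using z by (simp add: regular_values_def)
  then have zy: "z \<noteq> y" and zP': "z \<in> P" using y P(2) frontier_subset_closed by (auto simp: frontier_def)
  note h_img = simplicial_map_image[OF T FT, of a]
  define ws where "ws = some_order ?V"
  have ws: "distinct ws" "set ws = ?V" using some_order[OF finV] by (auto simp: ws_def)
  have len: "length ws = CARD('d)" using ws cardV distinct_card by metis
  define e :: "'d \<Rightarrow> 'b" where "e i = ws ! card {..<i}" for i
  have e: "bij_betw e UNIV ?V"
    using bij_betw_nth_card_lessThan[OF ws(1) len] ws(2) by (simp add: e_def[abs_def])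
  have "real_of_int (standard_orientation (y # map a ws)) = sgn (row_det (\<lambda>i. a (e i) - y))"
    unfolding sgn_standard_orientation using len card_lessThan_less[where ?'d='d]
    by (simp add: e_def)
  then have det: "row_det (\<lambda>i. a (e i) - y) \<noteq> 0" using nz by (auto simp: ws_def)
  obtain f where f_cont: "continuous_on UNIV f"
    and f: "\<And>u. u = (\<Sum>i\<in>UNIV. f u $ i *\<^sub>R (a (e i) - y))"
    "\<And>u c. u = (\<Sum>i\<in>UNIV. c i *\<^sub>R (a (e i) - y)) \<Longrightarrow> c = ($) (f u)"
    by (rule row_det_coordinates[OF det]) (rule that)
  have cone: "in_cone a y u ?V \<longleftrightarrow> (\<forall>k. 0 \<le> f u $ k)" for u
    using e f by (rule in_cone_iff_coordinates)
  have "((\<lambda>u. f u $ k) \<longlongrightarrow> f (z - y) $ k) (nhds (z - y))" for k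
    using f_cont by (intro tendsto_vec_nth) (simp add: continuous_on_eq_continuous_at isCont_def tendsto_nhds_iff)
  note lim = this
  show ?thesis
  proof (cases "in_cone a y (z - y) ?V")
    case True
    then obtain m where m: "\<And>v. v \<in> ?V \<Longrightarrow> 0 \<le> m v" and zm: "z - y = (\<Sum>v\<in>?V. m v *\<^sub>R (a v - y))"
      by (auto simp: in_cone_def)
    define s where "s = sum m ?V"
    have s0: "0 \<le> s" using m by (simp add: s_def sum_nonneg)
    have "s \<noteq> 0"
    proof
      assume "s = 0"
      then have "\<forall>v\<in>?V. m v = 0" using m finV by (simp add: s_def sum_nonneg_eq_0_iff)
      then show False using zm zy by simp
    qed
    then have s: "0 < s" using s0 by simp
    define q where "q = (\<Sum>v\<in>?V. (m v / s) *\<^sub>R a v)"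
    have qF: "q \<in> ?h ` F" unfolding h_img q_def
      using m s by (auto simp: s_def simp flip: sum_divide_distrib intro!: exI[of _ "\<lambda>v. m v / s"])
    then have qfr: "q \<in> frontier P" and qP: "q \<in> P" using fr P(2) frontier_subset_closed by blast+
    have "s *\<^sub>R q = (\<Sum>v\<in>?V. m v *\<^sub>R a v)" using s by (simp add: q_def scaleR_sum_right)
    then have zq: "z - y = s *\<^sub>R (q - y)"
      unfolding zm by (simp add: scaleR_diff_right sum_subtractf s_def scaleR_sum_left)
    \<comment> \<open>A ray from an interior point of a convex set meets the frontier only once: of
      \<open>q\<close> and \<open>z\<close>, the one nearer to \<open>y\<close> would be
      interior.\<close>
    have "s = 1"
    proof (rule ccontr)
      assume "s \<noteq> 1"
      then consider "s < 1" | "1 < s" by linarith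
      then show False
      proof cases
        case 1
        have "q - (1 - s) *\<^sub>R (q - y) \<in> interior P"
          by (rule mem_interior_convex_shrink[OF P(1) y qP]) (use 1 s in auto)
        moreover have "q - (1 - s) *\<^sub>R (q - y) = z" using zq by (simp add: algebra_simps)
        ultimately show False using zP by (simp add: frontier_def)
      next
        case 2
        have "z - (1 - 1/s) *\<^sub>R (z - y) \<in> interior P"
          by (rule mem_interior_convex_shrink[OF P(1) y zP']) (use 2 s in auto)
        moreover have "z - (1 - 1/s) *\<^sub>R (z - y) = y + (1/s) *\<^sub>R (z - y)" by (simp add: algebra_simps)
        moreover have "\<dots> = q" unfolding zq using s by simp
        ultimately show False using qfr by (simp add: frontier_def)
      qed
    qed
    then have "z = q" using zq by simp
    then have zF: "z \<in> ?h ` F" using qF by simp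
    \<comment> \<open>A vanishing coordinate would place \<open>z\<close> in the image of the face
      without \<open>e k\<close>. This face has dimension \<open>d - 2\<close> and is in the
      boundary complex, so regularity forbids it.\<close>
    have pos: "0 < f (z - y) $ k" for k
    proof (rule ccontr)
      assume "\<not> 0 < f (z - y) $ k"
      moreover have "m \<circ> e = ($) (f (z - y))"
        by (rule f(2)) (use zm sum.reindex_bij_betw[OF e, of "\<lambda>v. m v *\<^sub>R (a v - y)"] in simp)
      then have fm: "f (z - y) $ k = m (e k)" by (metis comp_apply)
      moreover have ek: "e k \<in> ?V" using e by (auto simp: bij_betw_def)
      ultimately have mk: "m (e k) = 0" using m[of "e k"] by simp
      let ?W = "?V - {e k}"
      let ?G = "convex hull ?W"
      have G: "?G \<in> T" "simplex_vertices ?G = ?W" "?G face_of F"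
        using complex_subsimplex[OF T FT, of ?W] by auto
      have "?G \<subseteq> F" using G(3) by (rule face_of_imp_subset)
      then have GB: "?G \<in> boundary_complex CARD('d) T"
        using F(1) G(1) by (auto simp: boundary_complex_def)
      have "(int CARD('d) - 2) simplex ?G"
        using cardV finV ek by (simp add: simplex_iff_card_vertices[OF T G(1)] G(2) card_Diff_singleton)
      then have "aff_dim ?G < int CARD('d) - 1" using aff_dim_simplex by fastforce
      then have "z \<notin> ?h ` ?G" using z GB by (auto simp: regular_values_def)
      moreover have "z \<in> ?h ` ?G"
        unfolding simplicial_map_image[OF T G(1)] G(2)
      proof (intro CollectI exI[of _ m] conjI)
        show "\<forall>v\<in>?W. 0 \<le> m v" using m by simp
        show "sum m ?W = 1" using \<open>s = 1\<close> mk sum.remove[OF finV ek, of m] by (simp add: s_def)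
        show "z = (\<Sum>v\<in>?W. m v *\<^sub>R a v)"
          using \<open>s = 1\<close> \<open>z = q\<close> mk sum.remove[OF finV ek, of "\<lambda>v. m v *\<^sub>R a v"] by (simp add: q_def)
      qed
      ultimately show False by simp
    qed
    have "eventually (\<lambda>u. \<forall>k. 0 < f u $ k) (nhds (z - y))"
      using order_tendstoD(1)[OF lim pos] by (simp add: eventually_all_finite)
    then show ?thesis
      by (rule eventually_mono) (simp add: cone zF less_imp_le)
  next
    case False
    have "z \<notin> ?h ` F"
    proof
      assume "z \<in> ?h ` F"
      then obtain m where m: "\<forall>v\<in>?V. 0 \<le> m v" "sum m ?V = 1" "z = (\<Sum>v\<in>?V. m v *\<^sub>R a v)"
        unfolding h_img by blast
      have "(\<Sum>v\<in>?V. m v *\<^sub>R y) = y" using m(2) by (simp flip: scaleR_sum_left)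
      then have "z - y = (\<Sum>v\<in>?V. m v *\<^sub>R (a v - y))"
        by (simp add: m(3) scaleR_diff_right sum_subtractf)
      then show False using False m(1) by (auto simp: in_cone_def)
    qed
    moreover obtain k where "f (z - y) $ k < 0" using False unfolding cone by (auto simp: not_le)
    then have "eventually (\<lambda>u. f u $ k < 0) (nhds (z - y))"
      by (rule order_tendstoD(2)[OF lim])
    then have "eventually (\<lambda>u. \<not> in_cone a y u ?V) (nhds (z - y))"
      by (rule eventually_mono) (metis cone not_le)
    ultimately show ?thesis by (simp add: eventually_mono)
  qed
qed

text \<open>The direction \<open>z - y\<close> may lie in the exceptional set, where
  \<open>N\<close> gives nothing. A generic direction close to it has the same crossings with
  boundary facets of nonzero sign, and the other facets contribute 0 to both sums.\<close>

lemma signed_preimage_count_eq: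
  fixes P :: "(real^'d::{finite,linorder}) set" and T :: "'b::euclidean_space set set"
    and a :: "'b \<Rightarrow> real^'d::{finite,linorder}"
  assumes P: "convex P" "closed P" and y: "y \<in> interior P"
    and T: "simplicial_complex T" and M: "compact_pl_manifold CARD('d) (\<Union>T)"
    and co: "compatible_orientation CARD('d) T ori"
    and fr: "simplicial_map T a ` manifold_boundary CARD('d) (\<Union>T) \<subseteq> frontier P"
    and z: "z \<in> regular_values T P (simplicial_map T a)"
    and neg: "finite \<N>" "\<And>N. N \<in> \<N> \<Longrightarrow> negligible N"
    and N: "\<And>u. u \<notin> \<Union>\<N> \<Longrightarrow>
      (\<Sum>F | F \<in> boundary_complex CARD('d) T \<and> (int CARD('d) - 1) simplex F.
            induced_orientation CARD('d) T ori (some_order (simplex_vertices F)) *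
            (standard_orientation (y # map a (some_order (simplex_vertices F))) *
             of_bool (in_cone a y u (simplex_vertices F)))) = k"
  shows "signed_preimage_count T ori P (simplicial_map T a) z = k"
proof -
  let ?h = "simplicial_map T a"
  define BF where "BF = {F. F \<in> boundary_complex CARD('d) T \<and> (int CARD('d) - 1) simplex F}"
  let ?so = "\<lambda>F. standard_orientation (y # map a (some_order (simplex_vertices F)))"
  let ?s = "\<lambda>F. induced_orientation CARD('d) T ori (some_order (simplex_vertices F)) * ?so F"
  have finBF: "finite BF" using T by (auto simp: BF_def boundary_complex_def simplicial_complex_def)
  have frF: "?h ` F \<subseteq> frontier P" if "F \<in> BF" for F
    using that fr by (auto simp: BF_def boundary_complex_def)
  have sign: "simplex_sign T ori P ?h F = ?s F" if "F \<in> BF" for F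
  proof -
    have F: "F \<in> boundary_complex CARD('d) T" "F \<in> T" "(int CARD('d) - 1) simplex F"
      using that by (auto simp: BF_def boundary_complex_def)
    obtain v where v: "cofacet_vertices CARD('d) T F = {v}"
      using boundary_facet_cofacet[OF T M _ F(1,3)] by auto
    show ?thesis
      using simplex_sign_eq_facet_sign[OF P y T co F(2,3) v frF[OF that]]
        induced_orientation_cofacet[OF v] some_order[OF simplex_vertices(2)[OF F(3)]]
      by (simp add: facet_sign_def)
  qed
  have "eventually (\<lambda>u. \<forall>F\<in>{F\<in>BF. ?so F \<noteq> 0}. in_cone a y u (simplex_vertices F) \<longleftrightarrow> z \<in> ?h ` F)
      (nhds (z - y))"
  proof (rule eventually_ball_finite)
    show "finite {F \<in> BF. ?so F \<noteq> 0}" using finBF by simp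
    show "\<forall>F\<in>{F \<in> BF. ?so F \<noteq> 0}.
        eventually (\<lambda>u. in_cone a y u (simplex_vertices F) \<longleftrightarrow> z \<in> ?h ` F) (nhds (z - y))"
      using frF eventually_in_cone_iff[OF P y T _ _ _ z] by (simp add: BF_def)
  qed
  then obtain Q where Q: "open Q" "z - y \<in> Q"
    "\<And>u F. u \<in> Q \<Longrightarrow> F \<in> BF \<Longrightarrow> ?so F \<noteq> 0 \<Longrightarrow> in_cone a y u (simplex_vertices F) \<longleftrightarrow> z \<in> ?h ` F"
    unfolding eventually_nhds by auto
  have "Q \<noteq> {}" using Q(2) by auto
  then obtain u where u: "u \<in> Q" "\<And>N. N \<in> \<N> \<Longrightarrow> u \<notin> N"
    using open_avoids_negligible[OF Q(1) _ neg] by metis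
  have "signed_preimage_count T ori P ?h z = (\<Sum>F\<in>{F\<in>BF. z \<in> ?h ` F}. simplex_sign T ori P ?h F)"
    unfolding signed_preimage_count_def BF_def by (rule sum.cong) auto
  also have "\<dots> = (\<Sum>F\<in>BF. if z \<in> ?h ` F then simplex_sign T ori P ?h F else 0)"
    using finBF by (rule sum.inter_filter)
  also have "\<dots> = (\<Sum>F\<in>BF. induced_orientation CARD('d) T ori (some_order (simplex_vertices F)) *
            (?so F * of_bool (in_cone a y u (simplex_vertices F))))"
    using sign Q(3)[OF u(1)] by (intro sum.cong) (auto simp: of_bool_def)
  also have "\<dots> = k" unfolding BF_def using N u(2) by blast
  finally show ?thesis .
qed

section \<open>Existence of regular values\<close>

lemma negligible_convex_hull_lowdim:
  fixes C :: "'a::euclidean_space set"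
  assumes "aff_dim C < DIM('a)"
  shows "negligible (convex hull C)"
  using assms low_dim_interior[of "convex hull C"]
  by (simp add: negligible_convex_interior aff_dim_convex_hull)

lemma negligible_span_few:
  fixes C :: "'a::euclidean_space set"
  assumes "finite C" "card C < DIM('a)"
  shows "negligible (span C)"
  using assms dim_le_card'[of C] by (intro negligible_lowdim) (simp add: dim_span)

text \<open>If the ray from \<open>y\<close> met the image of a simplex with fewer than
  \<open>d\<close> vertices, its direction would be in the span of fewer than \<open>d\<close>
  vectors. So a generic ray reaches the frontier at a regular value. Without one, every integer
  would satisfy the description in \<open>boundary_degree\<close>.\<close>

lemma regular_value_exists:
  fixes P :: "(real^'d::{finite,linorder}) set" and T :: "'b::euclidean_space set set"
    and a :: "'b \<Rightarrow> real^'d::{finite,linorder}"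
  assumes P: "bounded P" and y: "y \<in> interior P" and T: "simplicial_complex T"
  shows "regular_values T P (simplicial_map T a) \<noteq> {}"
proof -
  let ?N = "\<lambda>F. span ((\<lambda>v. a v - y) ` simplex_vertices F)"
  \<comment> \<open>\<open>{0}\<close> is added because a ray needs a nonzero direction.\<close>
  define \<N> where "\<N> = insert {0} (?N ` {F \<in> T. aff_dim F < int CARD('d) - 1})"
  have card: "card (simplex_vertices F) < CARD('d)" if "F \<in> T" "aff_dim F < int CARD('d) - 1" for F
    using that(2) aff_dim_affine_independent[OF complex_simplex_vertices(1)[OF T that(1)]]
      aff_dim_convex_hull[of "simplex_vertices F"] complex_simplex_vertices(3)[OF T that(1)] by simp
  have "negligible (?N F)" if "F \<in> T" "aff_dim F < int CARD('d) - 1" for F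
    using card[OF that] complex_simplex_vertices(2)[OF T that(1)]
    by (intro negligible_span_few) (auto intro: le_less_trans[OF card_image_le])
  then have "\<And>N. N \<in> \<N> \<Longrightarrow> negligible N" by (auto simp: \<N>_def)
  moreover have "finite \<N>" using T by (simp add: \<N>_def simplicial_complex_def)
  ultimately obtain u where u: "\<And>N. N \<in> \<N> \<Longrightarrow> u \<notin> N"
    using open_avoids_negligible[of UNIV \<N>] by auto
  then have "u \<noteq> 0" by (auto simp: \<N>_def)
  then obtain t where t: "0 < t" "y + t *\<^sub>R u \<in> frontier P"
    using ray_to_frontier[OF P y] by metis
  have "y + t *\<^sub>R u \<in> regular_values T P (simplicial_map T a)"
    unfolding regular_values_def
  proof (intro CollectI conjI t(2) ballI impI notI)
    fix F assume F: "F \<in> boundary_complex CARD('d) T" "aff_dim F < int CARD('d) - 1"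
      and im: "y + t *\<^sub>R u \<in> simplicial_map T a ` F"
    have FT: "F \<in> T" using F(1) by (simp add: boundary_complex_def)
    obtain m where m: "sum m (simplex_vertices F) = 1"
      "y + t *\<^sub>R u = (\<Sum>v\<in>simplex_vertices F. m v *\<^sub>R a v)"
      using im unfolding simplicial_map_image[OF T FT] by blast
    have "(\<Sum>v\<in>simplex_vertices F. m v *\<^sub>R y) = y" using m(1) by (simp flip: scaleR_sum_left)
    then have "t *\<^sub>R u = (\<Sum>v\<in>simplex_vertices F. m v *\<^sub>R (a v - y))"
      using m(2) by (simp add: scaleR_diff_right sum_subtractf algebra_simps)
    then have "t *\<^sub>R u \<in> ?N F" by (simp only:) (intro span_sum span_scale span_base imageI)
    then have "(1 / t) *\<^sub>R t *\<^sub>R u \<in> ?N F" by (rule span_scale)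
    then have "u \<in> ?N F" using t(1) by simp
    then show False using u[of "?N F"] F(2) FT by (auto simp: \<N>_def)
  qed
  then show ?thesis by blast
qed

text \<open>The case of a generic \<open>y\<close>. The total \<open>sum \<kappa> DS\<close> does
  not involve \<open>z\<close>, so it is the common value of all preimage counts, and it can be
  bounded simplex by simplex.\<close>

lemma boundary_degree_bound:
  fixes P :: "(real^'d::{finite,linorder}) set" and T :: "'b::euclidean_space set set"
    and a :: "'b \<Rightarrow> real^'d::{finite,linorder}"
  assumes P: "polytope P" and y: "y \<in> interior P"
    and T: "simplicial_complex T" and M: "compact_pl_manifold CARD('d) (\<Union>T)"
    and co: "compatible_orientation CARD('d) T ori"
    and fr: "simplicial_map T a ` manifold_boundary CARD('d) (\<Union>T) \<subseteq> frontier P"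
    and gen: "\<And>S W. S \<in> T \<Longrightarrow> W \<subseteq> simplex_vertices S \<Longrightarrow> card W \<le> CARD('d) \<Longrightarrow> y \<notin> convex hull (a ` W)"
  shows "\<bar>boundary_degree T ori P (simplicial_map T a)\<bar>
      \<le> int (card {S \<in> T. int CARD('d) simplex S \<and> y \<in> convex hull (a ` simplex_vertices S)})"
proof -
  let ?sv = simplex_vertices
  define DS where "DS = {S. S \<in> T \<and> int CARD('d) simplex S}"
  \<comment> \<open>One exceptional family for all simplices together, so that a single
    \<open>u\<close> is generic for every term of the sum.\<close>
  define \<N> where "\<N> = (\<lambda>W. span ((\<lambda>v. a v - y) ` W)) ` {W. \<exists>S\<in>T. W \<subseteq> ?sv S \<and> card W < CARD('d)}"
  have finT: "finite T" using T by (simp add: simplicial_complex_def)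
  then have finDS: "finite DS" by (simp add: DS_def)
  note T_vert = complex_simplex_vertices[OF T]
  have "{W. \<exists>S\<in>T. W \<subseteq> ?sv S \<and> card W < CARD('d)} \<subseteq> (\<Union>S\<in>T. Pow (?sv S))" by auto
  moreover have "finite (\<Union>S\<in>T. Pow (?sv S))" using finT T_vert(2) by simp
  ultimately have fin\<N>: "finite \<N>"
    unfolding \<N>_def by (intro finite_imageI) (rule finite_subset)
  have neg: "negligible N" if "N \<in> \<N>" for N
  proof -
    obtain S W where W: "S \<in> T" "W \<subseteq> ?sv S" "card W < CARD('d)" "N = span ((\<lambda>v. a v - y) ` W)"
      using \<open>N \<in> \<N>\<close> unfolding \<N>_def by blast
    have "finite W" using finite_subset[OF W(2) T_vert(2)[OF W(1)]] .
    then show ?thesis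
      using card_image_le[of W "\<lambda>v. a v - y"] W(3,4) by (auto intro!: negligible_span_few)
  qed
  have "\<forall>S\<in>DS. \<exists>k. \<bar>k\<bar> \<le> of_bool (y \<in> convex hull (a ` ?sv S)) \<and>
    (\<forall>u. (\<forall>W\<subseteq>?sv S. card W < CARD('d) \<longrightarrow> u \<notin> span ((\<lambda>v. a v - y) ` W)) \<longrightarrow>
       (\<Sum>v\<in>?sv S. facet_sign ori a y v (?sv S - {v}) * of_bool (in_cone a y u (?sv S - {v}))) = k)"
  proof
    fix S assume "S \<in> DS"
    then have S: "S \<in> T" "int CARD('d) simplex S" by (auto simp: DS_def)
    have card: "card (?sv S) = CARD('d) + 1" using simplex_vertices(3)[OF S(2)] by simp
    show "\<exists>k. \<bar>k\<bar> \<le> of_bool (y \<in> convex hull (a ` ?sv S)) \<and>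
      (\<forall>u. (\<forall>W\<subseteq>?sv S. card W < CARD('d) \<longrightarrow> u \<notin> span ((\<lambda>v. a v - y) ` W)) \<longrightarrow>
       (\<Sum>v\<in>?sv S. facet_sign ori a y v (?sv S - {v}) * of_bool (in_cone a y u (?sv S - {v}))) = k)"
    proof (rule facet_sum[OF T_vert(2)[OF S(1)] card alternating_on_simplex[OF co S]])
      fix W assume "W \<subset> ?sv S"
      then show "y \<notin> convex hull (a ` W)"
        using gen[OF S(1), of W] psubset_card_mono[OF T_vert(2)[OF S(1)], of W] card by auto
    qed
  qed
  then obtain \<kappa> where "\<forall>S\<in>DS. \<bar>\<kappa> S\<bar> \<le> of_bool (y \<in> convex hull (a ` ?sv S)) \<and>
    (\<forall>u. (\<forall>W\<subseteq>?sv S. card W < CARD('d) \<longrightarrow> u \<notin> span ((\<lambda>v. a v - y) ` W)) \<longrightarrow>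
       (\<Sum>v\<in>?sv S. facet_sign ori a y v (?sv S - {v}) * of_bool (in_cone a y u (?sv S - {v}))) = \<kappa> S)"
    by (rule bchoice[THEN exE])
  then have \<kappa>: "\<And>S. S \<in> DS \<Longrightarrow> \<bar>\<kappa> S\<bar> \<le> of_bool (y \<in> convex hull (a ` ?sv S))"
    "\<And>S u. S \<in> DS \<Longrightarrow> (\<forall>W\<subseteq>?sv S. card W < CARD('d) \<longrightarrow> u \<notin> span ((\<lambda>v. a v - y) ` W)) \<Longrightarrow>
       (\<Sum>v\<in>?sv S. facet_sign ori a y v (?sv S - {v}) * of_bool (in_cone a y u (?sv S - {v}))) = \<kappa> S"
    by blast+
  have count: "signed_preimage_count T ori P (simplicial_map T a) z = sum \<kappa> DS"
    if z: "z \<in> regular_values T P (simplicial_map T a)" for z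
  proof (rule signed_preimage_count_eq[OF polytope_imp_convex[OF P] polytope_imp_closed[OF P]
        y T M co fr z fin\<N> neg])
    fix u assume u: "u \<notin> \<Union>\<N>"
    let ?g = "\<lambda>W. standard_orientation (y # map a (some_order W)) * of_bool (in_cone a y u W)"
    have "(\<Sum>F | F \<in> boundary_complex CARD('d) T \<and> (int CARD('d) - 1) simplex F.
            induced_orientation CARD('d) T ori (some_order (?sv F)) * ?g (?sv F))
      = (\<Sum>S\<in>DS. \<Sum>v\<in>?sv S. ori (v # some_order (?sv S - {v})) * ?g (?sv S - {v}))"
      unfolding DS_def by (rule sum_facets_eq_sum_boundary[OF T M _ co, symmetric]) simp
    also have "\<dots> = sum \<kappa> DS"
    proof (rule sum.cong[OF refl])
      fix S assume S: "S \<in> DS"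
      have "\<forall>W\<subseteq>?sv S. card W < CARD('d) \<longrightarrow> u \<notin> span ((\<lambda>v. a v - y) ` W)"
        using u S unfolding \<N>_def DS_def by blast
      from \<kappa>(2)[OF S this]
      show "(\<Sum>v\<in>?sv S. ori (v # some_order (?sv S - {v})) * ?g (?sv S - {v})) = \<kappa> S"
        by (simp add: facet_sign_def mult.assoc)
    qed
    finally show "(\<Sum>F | F \<in> boundary_complex CARD('d) T \<and> (int CARD('d) - 1) simplex F.
            induced_orientation CARD('d) T ori (some_order (?sv F)) * ?g (?sv F)) = sum \<kappa> DS" .
  qed
  obtain z where z: "z \<in> regular_values T P (simplicial_map T a)"
    using regular_value_exists[OF polytope_imp_bounded[OF P] y T] by blast
  have "boundary_degree T ori P (simplicial_map T a) = sum \<kappa> DS"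
    unfolding boundary_degree_def
  proof (rule the_equality)
    show "\<forall>z\<in>regular_values T P (simplicial_map T a).
        signed_preimage_count T ori P (simplicial_map T a) z = sum \<kappa> DS"
      using count by blast
    show "k = sum \<kappa> DS" if "\<forall>z\<in>regular_values T P (simplicial_map T a).
        signed_preimage_count T ori P (simplicial_map T a) z = k" for k
      using that z count[OF z] by simp
  qed
  also have "\<bar>sum \<kappa> DS\<bar> \<le> (\<Sum>S\<in>DS. \<bar>\<kappa> S\<bar>)" by (rule sum_abs)
  also have "\<dots> \<le> (\<Sum>S\<in>DS. of_bool (y \<in> convex hull (a ` ?sv S)))"
    using \<kappa>(1) by (rule sum_mono)
  also have "\<dots> = int (card {S \<in> DS. y \<in> convex hull (a ` ?sv S)})"
    using finDS by (simp add: Int_def)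
  finally show ?thesis by (simp add: DS_def conj_assoc)
qed

section \<open>Reduction to a generic point\<close>

theorem theorem4p1:
  fixes P :: "(real^'d::{finite,linorder}) set"
    and p :: "nat \<Rightarrow> real^'d::{finite,linorder}"
    and n :: nat
    and M :: "'b::euclidean_space set"
    and T :: "'b set set"
    and ori :: "'b list \<Rightarrow> int"
    and L :: "'b \<Rightarrow> nat"
    and y :: "real^'d::{finite,linorder}"
  assumes "polytope P" and "aff_dim P = int CARD('d)"
    and "bij_betw p {1..n} {v. v extreme_point_of P}"
    and "compact_pl_manifold CARD('d) M"
    and "simplicial_complex T" and "\<Union>T = M"
    and "compatible_orientation CARD('d) T ori"
    and "L \<in> complex_vertices T \<rightarrow> {1..n}"
    and "simplicial_map T (\<lambda>v. p (L v)) ` manifold_boundary CARD('d) M \<subseteq> frontier P"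
    and "y \<in> P"
  shows "\<bar>boundary_degree T ori P (simplicial_map T (\<lambda>v. p (L v)))\<bar>
           \<le> int (card {S \<in> T. int CARD('d) simplex S \<and> labelled_in_cov n p y L S})"
proof -
  note T = \<open>simplicial_complex T\<close>
  define a where "a = (\<lambda>v. p (L v))"
  have Pc: "convex P" "closed P"
    using \<open>polytope P\<close> polytope_imp_convex polytope_imp_closed by auto
  have "affine hull P = UNIV" using \<open>aff_dim P = int CARD('d)\<close> aff_dim_eq_full[of P] by simp
  then have "interior P \<noteq> {}"
    using Pc(1) \<open>y \<in> P\<close> rel_interior_eq_empty[of P] by (auto simp: rel_interior_interior)
  then have y_cl: "y \<in> closure (interior P)"
    using convex_closure_interior[OF Pc(1)] Pc(2) \<open>y \<in> P\<close> by simp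
  have finI: "finite {I. I \<subseteq> {1..n} \<and> Q I}" for Q :: "nat set \<Rightarrow> bool"
    by (rule finite_subset[of _ "Pow {1..n}"]) auto
  \<comment> \<open>With the hulls that miss \<open>y\<close> removed, every hull of labels that
    meets \<open>B\<close> contains \<open>y\<close>. The removed hulls are closed and finite in
    number, so their complement is a neighbourhood of \<open>y\<close>, and it meets the interior of
    \<open>P\<close> even if \<open>y\<close> is on the frontier.\<close>
  define B where "B = interior P \<inter> - (\<Union>I\<in>{I. I \<subseteq> {1..n} \<and> y \<notin> convex hull (p ` I)}. convex hull (p ` I))"
  have "closed (convex hull (p ` I))" if "I \<subseteq> {1..n}" for I
    using finite_subset[OF that] by (intro compact_imp_closed finite_imp_compact_convex_hull) auto
  then have open_far: "open (- (\<Union>I\<in>{I. I \<subseteq> {1..n} \<and> y \<notin> convex hull (p ` I)}. convex hull (p ` I)))"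
    using finI by (intro open_Compl closed_UN) auto
  then have openB: "open B" unfolding B_def by (intro open_Int) auto
  have neB: "B \<noteq> {}"
    unfolding B_def using open_Int_closure_eq_empty[OF open_far, of "interior P"] y_cl
    by (auto simp: Int_commute)
  have negN: "negligible N"
    if "N \<in> (\<lambda>I. convex hull (p ` I)) ` {I. I \<subseteq> {1..n} \<and> aff_dim (p ` I) < int CARD('d)}" for N
    using that by (auto intro!: negligible_convex_hull_lowdim)
  obtain y' where y': "y' \<in> B"
    and y'N: "\<And>N. N \<in> (\<lambda>I. convex hull (p ` I)) ` {I. I \<subseteq> {1..n} \<and> aff_dim (p ` I) < int CARD('d)} \<Longrightarrow> y' \<notin> N"
    by (rule open_avoids_negligible[OF openB neB finite_imageI[OF finI] negN]) (assumption, rule that)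
  have gen: "y' \<notin> convex hull (p ` I)" if "I \<subseteq> {1..n}" "aff_dim (p ` I) < int CARD('d)" for I
    using y'N that by blast
  have near: "y \<in> convex hull (p ` I)" if "I \<subseteq> {1..n}" "y' \<in> convex hull (p ` I)" for I
    using y' that by (auto simp: B_def)
  \<comment> \<open>At most \<open>d\<close> points span affine dimension below \<open>d\<close>.
    This covers proper faces as well as \<open>d\<close>-simplices of \<open>T\<close> with repeated
    labels.\<close>
  have few: "y' \<notin> convex hull (p ` I)" if "I \<subseteq> {1..n}" "card I \<le> CARD('d)" for I
  proof (rule gen[OF that(1)])
    have "finite I" using that(1) finite_subset by blast
    then show "aff_dim (p ` I) < int CARD('d)"
      using aff_dim_le_card[of "p ` I"] card_image_le[of I p] that(2) by simp
  qed
  have labels: "L ` W \<subseteq> {1..n}" if "S \<in> T" "W \<subseteq> simplex_vertices S" for S W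
  proof -
    have "{v} \<in> T" if "v \<in> W" for v
      using complex_subsimplex(1)[OF T \<open>S \<in> T\<close>, of "{v}"] that \<open>W \<subseteq> simplex_vertices S\<close> by auto
    then show ?thesis using assms(8) by (auto simp: complex_vertices_def)
  qed
  have "\<bar>boundary_degree T ori P (simplicial_map T a)\<bar>
      \<le> int (card {S \<in> T. int CARD('d) simplex S \<and> y' \<in> convex hull (a ` simplex_vertices S)})"
  proof (rule boundary_degree_bound[OF \<open>polytope P\<close> _ T _ \<open>compatible_orientation CARD('d) T ori\<close>])
    show "y' \<in> interior P" using y' by (simp add: B_def)
    show "compact_pl_manifold CARD('d) (\<Union>T)" using assms by simp
    show "simplicial_map T a ` manifold_boundary CARD('d) (\<Union>T) \<subseteq> frontier P" using assms by (simp add: a_def)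
    fix S W assume S: "S \<in> T" "W \<subseteq> simplex_vertices S" "card W \<le> CARD('d)"
    have "finite W" using S complex_simplex_vertices(2)[OF T] finite_subset by blast
    then have "card (L ` W) \<le> CARD('d)" using card_image_le[of W L] S(3) by linarith
    then show "y' \<notin> convex hull (a ` W)" using few[OF labels[OF S(1,2)]] by (simp add: a_def image_image)
  qed
  also have "card {S \<in> T. int CARD('d) simplex S \<and> y' \<in> convex hull (a ` simplex_vertices S)}
      \<le> card {S \<in> T. int CARD('d) simplex S \<and> labelled_in_cov n p y L S}"
  proof (rule card_mono)
    show "finite {S \<in> T. int CARD('d) simplex S \<and> labelled_in_cov n p y L S}"
      using T by (simp add: simplicial_complex_def)
    have "labelled_in_cov n p y L S"
      if S: "S \<in> T" "int CARD('d) simplex S" "y' \<in> convex hull (a ` simplex_vertices S)" for S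
    proof -
      define I where "I = L ` simplex_vertices S"
      have I: "I \<subseteq> {1..n}" using labels[OF S(1) order_refl] by (simp add: I_def)
      have y'I: "y' \<in> convex hull (p ` I)" using S(3) by (simp add: I_def a_def image_image)
      have "card I \<le> CARD('d) + 1"
        using card_image_le[OF simplex_vertices(2)[OF S(2)], of L] simplex_vertices(3)[OF S(2)]
        by (simp add: I_def)
      then have card: "card I = CARD('d) + 1" using few[OF I] y'I by linarith
      have "inj_on p I" using assms(3) I by (auto simp: bij_betw_def intro: inj_on_subset)
      then have cp: "card (p ` I) = CARD('d) + 1" using card by (simp add: card_image)
      \<comment> \<open>Distinct labels do not yet give a nondegenerate simplex, since vertices of
        \<open>P\<close> may be affinely dependent. As \<open>y'\<close> avoids the flat hulls,
        these \<open>d + 1\<close> points span dimension \<open>d\<close>.\<close>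
      have "int CARD('d) \<le> aff_dim (p ` I)" using gen[OF I] y'I by linarith
      moreover have "finite (p ` I)" using I finite_subset by blast
      ultimately have "\<not> affine_dependent (p ` I)"
        using aff_dim_le_card[of "p ` I"] cp unfolding affine_independent_iff_card by simp
      then have "int CARD('d) simplex (convex hull (p ` I))"
        unfolding simplex_def using cp by (intro exI[of _ "p ` I"]) simp
      then have "convex hull (p ` I) \<in> cov n p y"
        using I card near[OF I y'I] unfolding cov_def by blast
      then show ?thesis unfolding labelled_in_cov_def using I card by (auto simp: I_def)
    qed
    then show "{S \<in> T. int CARD('d) simplex S \<and> y' \<in> convex hull (a ` simplex_vertices S)}
      \<subseteq> {S \<in> T. int CARD('d) simplex S \<and> labelled_in_cov n p y L S}" by blast
  qed
  finally show ?thesis by (simp add: a_def)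
qed

end
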